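(* There exists a constant $C_{N,s}>0$, depending only on $N$ and $s$, such that the following holds. Let $D$ be an open set in $\mathbb{R}^N$ (possibly unbounded and disconnected) and let $d(D):=\sup_{x\in D}\mathrm{dist}(x,D^c)$ be the width of $D$. Assume that $$\frac{\big|\big(B_{c_2r_x}(x)\setminus B_{r_x}(x)\big)\cap D^c\big|}{|B_{c_2r_x}(x)\setminus B_{r_x}(x)|}\ge c_1\qquad\text{for all }x\in D,$$ for some constants $c_1>0$ and $c_2>1$, where $r_x=\mathrm{dist}(x,D^c)\le d(D)$. Suppose that $w\in\mathcal{L}_s(\mathbb{R}^N)\cap C^{1,1}_{loc}(D)$ is bounded from below and satisfies $$\begin{cases}(-\Delta+m^2)^s w(x)+c(x)w(x)\ge 0 & \text{at points } x\in D\text{ where } w(x)<0,\\ w(x)\ge 0 & \text{in } D^c,\end{cases}$$ where $c(x)$ is uniformly bounded from below (w.r.t. $d(D)$) in $\{x\in D: w(x)<0\}$. Assume that $d(D)\le\frac{r_0}{c_2m}$, and that either $$\inf_{\{x\in D\,:\,w(x)<0\}}c(x)>-\left\{1+\frac{c_2^{2s}C_{N,s}}{r_0^{2s}}\left[\frac1{c_2(1+c_2)}\right]^{N+2s}(c_2^N-1)c_1\right\}m^{2s},$$ or $$-[d(D)]^{2s}\left(\inf_{\{x\in D\,:\,w(x)<0\}}c(x)+m^{2s}\right)<C_{N,s}\left[\frac1{c_2(1+c_2)}\right]^{N+2s}(c_2^N-1)c_1.$$ Then $w(x)\ge 0$ in $D$. Furthermore, if in addition $(-\Delta+m^2)^s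 w(x)\ge 0$ at points $x\in D$ where $w(x)=0$, then either $w(x)>0$ in $D$ or $w(x)=0$ a.e. in $\mathbb{R}^N$.
   Context: Let $N\ge 1$ be an integer, $0<s<1$, $m>0$. $D^c=\mathbb{R}^N\setminus D$ and $|A|$ is the Lebesgue measure of $A$. $K_\nu$ is the modified Bessel function of the second kind of order $\nu$, $K_\nu(r)=\int_0^\infty e^{-r\cosh t}\cosh(\nu t)\,dt$ for $r>0$. The number $r_0>0$ is a fixed small number, depending only on $N$ and $s$, for which there are constants $C_0>c_0>0$ with $c_0r^{-\nu}\le K_\nu(r)\le C_0r^{-\nu}$ for all $0<r\le r_0$, where $\nu=\frac N2+s$. The operator $(-\Delta+m^2)^s$ is defined by $$(-\Delta+m^2)^s u(x)=c_{N,s}m^{\frac N2+s}\,\mathrm{P.V.}\int_{\mathbb{R}^N}\frac{u(x)-u(y)}{|x-y|^{\frac N2+s}}K_{\frac N2+s}(m|x-y|)\,dy+m^{2s}u(x),\qquad c_{N,s}=2^{1-\frac N2+s}\pi^{-\frac N2}\frac{s(1-s)}{\Gamma(2-s)},$$ where P.V. denotes the Cauchy principal value (the constant $c_{N,s}$ is not the constant $C_{N,s}$ of the claim). The function space is $\mathcal{L}_s(\mathbb{R}^N)=\{u:\mathbb{R}^N\to\mathbb{R}\,:\,\int_{\mathbb{R}^N}\frac{e^{-|x|}|u(x)|}{1+|x|^{\frac{N+1}2+s}}dx<\infty\}$. $C^{1,1}_{loc}$ denotes $C^1$ functions with locally Lipschitz gradient. "Uniformly bounded from below (w.r.t. $d(D)$)"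 means bounded from below by a constant not depending on $d(D)$; for a fixed $D$ this is just boundedness from below. Convention: whenever the operator is applied to a function $u$, it is understood that $\int_{|y-x|\ge1}\frac{|u(y)|}{|x-y|^{N/2+s}}K_{\frac N2+s}(m|x-y|)\,dy<\infty$ for every $x\in\mathbb{R}^N$, so that $(-\Delta+m^2)^su$ is well defined where $u$ is locally $C^{1,1}$ (this is automatic for $u\in\mathcal{L}_s(\mathbb{R}^N)$ if $m\ge1$). *)

theory Defs
  imports "HOL-Analysis.Analysis"
begin

text \<open>The space dimension is the cardinality of the index type: points live in
  \<^typ>\<open>real ^ 'n\<close>. All integrals and measures are with respect to the completed Lebesgue
  measure, so that Lebesgue measurable (not only Borel) functions are covered.\<close>

definition bessel_K :: "real \<Rightarrow> real \<Rightarrow> real" where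
  "bessel_K \<nu> r = (LINT t:{0..}|lebesgue. exp (- r * cosh t) * cosh (\<nu> * t))"

text \<open>On \<open>(0, r0]\<close> the function \<open>K\<^sub>\<nu>(r)\<close> is comparable to \<open>r\<^sup>-\<^sup>\<nu>\<close>.\<close>

definition bessel_comparison_radius :: "real \<Rightarrow> real \<Rightarrow> bool" where
  "bessel_comparison_radius \<nu> r0 \<longleftrightarrow>
     0 < r0 \<and>
     (\<exists>c0 C0. 0 < c0 \<and> c0 < C0 \<and>
        (\<forall>r. 0 < r \<and> r \<le> r0 \<longrightarrow>
           c0 * r powr (- \<nu>) \<le> bessel_K \<nu> r \<and> bessel_K \<nu> r \<le> C0 * r powr (- \<nu>)))"

definition bessel_kernel :: "real \<Rightarrow> real \<Rightarrow> real ^ 'n \<Rightarrow> real ^ 'n \<Rightarrow> real" where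
  "bessel_kernel m s x y =
     bessel_K (real CARD('n) / 2 + s) (m * norm (x - y)) / norm (x - y) powr (real CARD('n) / 2 + s)"

definition op_const :: "'n::finite itself \<Rightarrow> real \<Rightarrow> real" where
  "op_const _ s =
     2 powr (1 - real CARD('n) / 2 + s) * pi powr (- (real CARD('n) / 2)) * (s * (1 - s) / Gamma (2 - s))"

text \<open>The operator \<open>(-\<Delta> + m\<^sup>2)\<^sup>s\<close>. The principal value is the limit, as \<open>\<epsilon>\<close> decreases to \<open>0\<close>, of
  the integrals over the complement of the \<open>\<epsilon>\<close>-ball. \<^const>\<open>Lim\<close> and the Bochner integral are
  total, so the value is meaningful only where the truncated integrals exist and converge; this
  is the case where \<open>u\<close> is locally \<open>C\<^sup>1\<^sup>,\<^sup>1\<close> if \<open>u\<close> is locally integrable and has the tail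
  integrability stated in \<open>tail_integrable\<close> below.\<close>

definition bessel_op :: "real \<Rightarrow> real \<Rightarrow> (real ^ 'n \<Rightarrow> real) \<Rightarrow> real ^ 'n \<Rightarrow> real" where
  "bessel_op m s u x =
     op_const TYPE('n) s * m powr (real CARD('n) / 2 + s) *
       Lim (at_right 0) (\<lambda>\<epsilon>. LINT y:{y. \<epsilon> \<le> norm (x - y)}|lebesgue. (u x - u y) * bessel_kernel m s x y)
     + m powr (2 * s) * u x"

definition tail_integrable :: "real \<Rightarrow> real \<Rightarrow> (real ^ 'n \<Rightarrow> real) \<Rightarrow> bool" where
  "tail_integrable m s u \<longleftrightarrow>
     (\<forall>x. set_integrable lebesgue {y. 1 \<le> norm (y - x)} (\<lambda>y. \<bar>u y\<bar> * bessel_kernel m s x y))"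

text \<open>The space \<open>\<L>\<^sub>s(\<real>\<^sup>N)\<close>. Measurability of \<open>u\<close> is listed separately, since integrability of an
  expression in \<open>\<bar>u\<bar>\<close> does not imply it.\<close>

definition L_space :: "real \<Rightarrow> (real ^ 'n \<Rightarrow> real) set" where
  "L_space s =
     {u. u \<in> borel_measurable lebesgue \<and>
         integrable lebesgue
           (\<lambda>x. exp (- norm x) * \<bar>u x\<bar> / (1 + norm x powr ((real CARD('n) + 1) / 2 + s)))}"

text \<open>Local Lipschitz continuity of the gradient entails its continuity.\<close>

definition C11_loc :: "(real ^ 'n) set \<Rightarrow> (real ^ 'n \<Rightarrow> real) set" where
  "C11_loc D =
     {u. \<exists>g. (\<forall>x\<in>D. GDERIV u x :> g x) \<and>
             (\<forall>x\<in>D. \<exists>e>0. \<exists>L. L-lipschitz_on (ball x e \<inter> D) g)}"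

text \<open>The width \<open>d(D)\<close>, as an extended nonnegative number: it is \<open>\<infinity>\<close> if the distances to the
  complement are unbounded or if \<open>D\<close> is the whole space (\<^const>\<open>infdist\<close> would give \<open>0\<close> in the
  latter case), and \<open>0\<close> if \<open>D\<close> is empty.\<close>

definition width :: "(real ^ 'n) set \<Rightarrow> ennreal" where
  "width D = (SUP x\<in>D. INF y\<in>-D. ennreal (dist x y))"

definition annulus :: "real ^ 'n \<Rightarrow> real \<Rightarrow> real \<Rightarrow> (real ^ 'n) set" where
  "annulus x r R = ball x R - ball x r"

text \<open>Here \<open>infdist x (- D)\<close> is \<open>r\<^sub>x\<close>; this is correct as soon as \<open>D\<close> is not the whole space, which
  is guaranteed whenever \<open>width D\<close> is finite.\<close>

definition exterior_density :: "(real ^ 'n) set \<Rightarrow> real \<Rightarrow> real \<Rightarrow> bool" where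
  "exterior_density D c1 c2 \<longleftrightarrow>
     (\<forall>x\<in>D. let r = infdist x (- D) in
        measure lebesgue (annulus x r (c2 * r) \<inter> - D) / measure lebesgue (annulus x r (c2 * r)) \<ge> c1)"

text \<open>The infimum is taken in the extended reals, so that it is \<open>\<infinity>\<close> if \<open>w\<close> is nowhere negative
  in \<open>D\<close>.\<close>

definition inf_coeff ::
  "(real ^ 'n) set \<Rightarrow> (real ^ 'n \<Rightarrow> real) \<Rightarrow> (real ^ 'n \<Rightarrow> real) \<Rightarrow> ereal" where
  "inf_coeff D w c = (INF x\<in>{x \<in> D. w x < 0}. ereal (c x))"

end

theory Submission
  imports Defs
begin

text \<open>Why the maximum principle holds. The kernel of the operator is \<open>K\<^sub>\<nu>(m|x - y|) / |x - y|\<^sup>\<nu>\<close> with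
  \<open>\<nu> = N/2 + s\<close>; it is comparable to \<open>m\<^sup>-\<^sup>\<nu> (|x - y| powr (-(N + 2s)))\<close> as long as
  \<open>m|x - y| \<le> r0\<close>, and bounded by a multiple of that power everywhere. Suppose that \<open>w\<close> is negative
  somewhere and let \<open>\<mu> < 0\<close> be its infimum. If \<open>w\<close> attained \<open>\<mu>\<close> at \<open>z \<in> D\<close>, then \<open>w(z) - w(y) \<le> 0\<close>
  for all \<open>y\<close>, and \<open>w(z) - w(y) \<le> \<mu>\<close> on the part of the annulus between the radii \<open>r = r\<^sub>z\<close> and
  \<open>c2 r\<close> that lies outside \<open>D\<close>. By the density hypothesis that part has measure at least
  \<open>c1 \<omega>\<^sub>N (c2\<^sup>N - 1) r\<^sup>N\<close>, and the width hypothesis puts it in the range of the lower bound for the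
  kernel, so the operator applied to \<open>w\<close> at \<open>z\<close> is at most \<open>\<mu> (A r powr (-2s) + m powr (2s))\<close>
  for an explicit \<open>A\<close>. Either of the two conditions on \<open>c\<close> says that
  \<open>A + r powr (2s) (m powr (2s) + c(z))\<close> is bounded below by a positive constant
  (\<open>coefficient_condition\<close>, \<open>annulus_weight_less\<close>), which contradicts the differential inequality.

  In general the infimum is not attained, since \<open>D\<close> may be unbounded. So a point \<open>x\<close> with
  \<open>w(x) < \<mu> + \<epsilon>\<close> is chosen, and the sum of \<open>w\<close> and the paraboloid \<open>\<epsilon> |y - x|\<^sup>2 / \<rho>\<^sup>2\<close> with
  \<open>\<rho> = r\<^sub>x / 2\<close> is minimised on the closed \<open>\<rho>\<close>-ball around \<open>x\<close>; the minimum over the ball is a global one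
  (\<open>touching_paraboloid\<close>). At the minimum point \<open>z\<close>, \<open>w(z) - w(y)\<close> is bounded by a linear term in \<open>y - z\<close>,
  which the principal value does not see, plus \<open>\<epsilon> |z - y|\<^sup>2 / \<rho>\<^sup>2\<close>, and also by \<open>\<epsilon>\<close>. Using the
  first bound on the \<open>\<rho>\<close>-ball around \<open>z\<close> and the second outside it costs an error of order
  \<open>\<epsilon> \<rho> powr (-2s)\<close>. This has the same homogeneity as the main term because \<open>\<rho>\<close> and \<open>r\<^sub>z\<close> are
  comparable, so the contradiction survives for small \<open>\<epsilon>\<close>, however small \<open>r\<^sub>z\<close> is
  (\<open>bessel_op_le_at_touching_point\<close>, \<open>nonneg_of_coefficient_gap\<close>).

  For the second assertion, at a zero \<open>x \<in> D\<close> of the nonnegative function \<open>w\<close> all truncated integrals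
  are nonpositive and become smaller as the truncation radius shrinks; a nonnegative limit forces all of them to
  vanish, hence \<open>w = 0\<close> almost everywhere by positivity of the kernel.

  The limit in the definition of the operator carries information only if it exists. That it does at
  the points of \<open>D\<close> is \<open>principal_value_converges\<close>, where the \<open>C\<^sup>1\<^sup>,\<^sup>1\<close> regularity enters.\<close>

section \<open>Integrals of powers of the distance\<close>

text \<open>On the shell between the radii \<open>r k\<close> and \<open>2 * r k\<close> the integrand is comparable to \<open>r k powr p\<close>,
  so each shell contributes at most a multiple of \<open>r k\<close> to the power \<open>N + p\<close>. With dyadic radii the sum
  is a geometric series, and this one estimate serves both for small balls and for tails.\<close>

lemma nn_integral_powr_shells_le:
  fixes x :: "real ^ 'n"
  assumes r: "\<And>k. 0 < r k"
    and sums: "(\<lambda>k. r k powr (real CARD('n) + p)) sums T"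
    and cover: "\<And>y. y \<in> B \<Longrightarrow> y \<noteq> x \<Longrightarrow> \<exists>k::nat. r k \<le> norm (x - y) \<and> norm (x - y) < 2 * r k"
  shows "(\<integral>\<^sup>+y\<in>B. ennreal (norm (x - y) powr p) \<partial>lebesgue)
    \<le> ennreal (2 powr \<bar>p\<bar> * unit_ball_vol (real CARD('n)) * 2 ^ CARD('n) * T)"
proof -
  have pt: "ennreal (norm (x - y) powr p) * indicator B y
      \<le> (\<Sum>k. ennreal (2 powr \<bar>p\<bar> * r k powr p) * indicator (ball x (2 * r k)) y)" for y
  proof (cases "y \<in> B \<and> y \<noteq> x")
    case True
    define F where "F = (\<lambda>k. ennreal (2 powr \<bar>p\<bar> * r k powr p) * indicator (ball x (2 * r k)) y)"
    from True obtain k where k: "r k \<le> norm (x - y)" "norm (x - y) < 2 * r k"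
      using cover by blast
    have "norm (x - y) powr p \<le> 2 powr \<bar>p\<bar> * r k powr p"
    proof (cases "p \<ge> 0")
      case True
      have "norm (x - y) powr p \<le> (2 * r k) powr p"
        using True k by (intro powr_mono2) auto
      then show ?thesis using True r[of k] by (simp add: powr_mult)
    next
      case False
      have "norm (x - y) powr p \<le> r k powr p"
        using False k r[of k] by (intro powr_mono2') auto
      also have "\<dots> \<le> 2 powr \<bar>p\<bar> * r k powr p"
        using ge_one_powr_ge_zero[of 2 "\<bar>p\<bar>"] by (simp add: mult_le_cancel_right1)
      finally show ?thesis .
    qed
    then have "ennreal (norm (x - y) powr p) * indicator B y
        \<le> ennreal (2 powr \<bar>p\<bar> * r k powr p) * indicator (ball x (2 * r k)) y"
      using k True by (auto simp: dist_norm intro!: ennreal_leI)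
    also have "\<dots> = F k" by (simp only: F_def)
    also have "\<dots> = sum F {k}" by simp
    also have "\<dots> \<le> suminf F"
      by (rule sum_le_suminf[OF summableI]) simp_all
    finally show ?thesis unfolding F_def .
  next
    case False
    then show ?thesis by (cases "y = x") auto
  qed
  have vol: "ennreal (2 powr \<bar>p\<bar> * r k powr p) * emeasure lebesgue (ball x (2 * r k))
      = ennreal (2 powr \<bar>p\<bar> * unit_ball_vol (real CARD('n)) * 2 ^ CARD('n) * r k powr (real CARD('n) + p))" for k
  proof -
    have "emeasure lebesgue (ball x (2 * r k))
        = ennreal (unit_ball_vol (real CARD('n)) * (2 * r k) ^ CARD('n))"
      using r[of k] by (simp add: emeasure_ball)
    moreover have "r k powr (real CARD('n) + p) = r k ^ CARD('n) * r k powr p"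
      using r[of k] by (simp add: powr_add powr_realpow)
    ultimately show ?thesis
      using r[of k] by (simp add: ennreal_mult'[symmetric] power_mult_distrib mult_ac)
  qed
  have "(\<integral>\<^sup>+y\<in>B. ennreal (norm (x - y) powr p) \<partial>lebesgue)
    \<le> (\<integral>\<^sup>+y. (\<Sum>k. ennreal (2 powr \<bar>p\<bar> * r k powr p) * indicator (ball x (2 * r k)) y) \<partial>lebesgue)"
    by (rule nn_integral_mono) (rule pt)
  also have "\<dots> = (\<Sum>k. \<integral>\<^sup>+y. ennreal (2 powr \<bar>p\<bar> * r k powr p) * indicator (ball x (2 * r k)) y \<partial>lebesgue)"
    by (rule nn_integral_suminf)
       (intro borel_measurable_times_ennreal borel_measurable_const borel_measurable_indicator
          lmeasurable_ball[THEN fmeasurableD])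
  also have "\<dots> = (\<Sum>k. ennreal (2 powr \<bar>p\<bar> * r k powr p) * emeasure lebesgue (ball x (2 * r k)))"
    by (simp only: nn_integral_cmult_indicator[OF lmeasurable_ball[THEN fmeasurableD]])
  also have "\<dots> = (\<Sum>k. ennreal (2 powr \<bar>p\<bar> * unit_ball_vol (real CARD('n)) * 2 ^ CARD('n)
                            * r k powr (real CARD('n) + p)))"
    by (simp only: vol)
  also have "\<dots> = ennreal (2 powr \<bar>p\<bar> * unit_ball_vol (real CARD('n)) * 2 ^ CARD('n) * T)"
    by (intro suminf_ennreal_eq sums_mult sums) (auto intro!: mult_nonneg_nonneg)
  finally show ?thesis .
qed

lemma set_integral_le_of_nn_integral:
  fixes f :: "'a \<Rightarrow> real"
  assumes [measurable]: "f \<in> borel_measurable M" "B \<in> sets M"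
    and "\<And>y. 0 \<le> f y" and K: "0 \<le> K" "(\<integral>\<^sup>+y\<in>B. ennreal (f y) \<partial>M) \<le> ennreal K"
  shows "set_integrable M B f" "(LINT y:B|M. f y) \<le> K"
proof -
  have eq: "(\<integral>\<^sup>+y. ennreal (indicator B y *\<^sub>R f y) \<partial>M) = (\<integral>\<^sup>+y\<in>B. ennreal (f y) \<partial>M)"
    by (intro nn_integral_cong) (auto split: split_indicator)
  show "set_integrable M B f"
    unfolding set_integrable_def
  proof (rule integrableI_nonneg)
    show "(\<integral>\<^sup>+y. ennreal (indicator B y *\<^sub>R f y) \<partial>M) < \<infinity>"
      using K(2) unfolding eq by (simp add: le_less_trans)
  qed (auto simp: assms)
  show "(LINT y:B|M. f y) \<le> K"
    unfolding set_lebesgue_integral_def by (rule integral_real_bounded) (use K eq in auto)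
qed

lemma set_integrable_dominated:
  fixes f g :: "'a \<Rightarrow> real"
  assumes "set_integrable M A f" "g \<in> borel_measurable M" "A \<in> sets M"
    and le: "\<And>x. x \<in> A \<Longrightarrow> \<bar>g x\<bar> \<le> f x"
  shows "set_integrable M A g"
proof (rule set_integrable_bound[OF assms(1)])
  show "set_borel_measurable M A g"
    unfolding set_borel_measurable_def
    by (intro borel_measurable_scaleR borel_measurable_indicator assms)
  have "norm (g x) \<le> norm (f x)" if "x \<in> A" for x
    using le[OF that] by simp
  then show "AE x in M. x \<in> A \<longrightarrow> norm (g x) \<le> norm (f x)" by simp
qed

lemma dyadic_index:
  fixes t :: real
  assumes "1 \<le> t"
  obtains k :: nat where "2 ^ k \<le> t" "t < 2 ^ Suc k"
proof
  let ?k = "nat \<lfloor>log 2 t\<rfloor>"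
  have l: "0 \<le> log 2 t" using assms by simp
  have "real ?k \<le> log 2 t" using l by linarith
  then have "2 powr real ?k \<le> t" using assms by (simp only: le_log_iff)
  then show "2 ^ ?k \<le> t" by (simp add: powr_realpow)
  have "log 2 t < real (Suc ?k)" using l by linarith
  then have "t < 2 powr real (Suc ?k)" using assms by (simp only: log_less_iff)
  then show "t < 2 ^ Suc ?k" by (simp only: powr_realpow zero_less_numeral)
qed

lemma norm_diff_powr_measurable [measurable]:
  "(\<lambda>y. norm (x - y) powr p) \<in> borel_measurable (lebesgue :: 'a::euclidean_space measure)"
  by (rule measurable_completion) measurable

text \<open>The dependence on the radius \<open>\<rho>\<close> is that dictated by scaling, with a constant uniform in \<open>\<rho>\<close>; this
  is what makes error terms comparable with the main term near the boundary of the domain.\<close>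

lemma powr_integral_ball:
  fixes p :: real
  assumes "0 < real CARD('n::finite) + p"
  obtains C where "0 \<le> C"
    "\<And>(x::real ^ 'n) \<rho>. 0 < \<rho> \<Longrightarrow> set_integrable lebesgue (ball x \<rho>) (\<lambda>y. norm (x - y) powr p)"
    "\<And>(x::real ^ 'n) \<rho>. 0 < \<rho> \<Longrightarrow>
        (LINT y:ball x \<rho>|lebesgue. norm (x - y) powr p) \<le> C * \<rho> powr (real CARD('n) + p)"
proof -
  define a where "a = real CARD('n) + p"
  define q where "q = 2 powr (- a)"
  define C where "C = 2 powr \<bar>p\<bar> * unit_ball_vol (real CARD('n)) * 2 ^ CARD('n) * (q / (1 - q))"
  have q: "0 < q" "q < 1" using assms by (auto simp: q_def a_def powr_less_one)
  have C: "0 \<le> C" using q by (simp add: C_def)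
  have "(\<integral>\<^sup>+y\<in>ball x \<rho>. ennreal (norm (x - y) powr p) \<partial>lebesgue) \<le> ennreal (C * \<rho> powr a)"
    if \<rho>: "0 < \<rho>" for x :: "real ^ 'n" and \<rho>
  proof -
    have "(\<integral>\<^sup>+y\<in>ball x \<rho>. ennreal (norm (x - y) powr p) \<partial>lebesgue)
       \<le> ennreal (2 powr \<bar>p\<bar> * unit_ball_vol (real CARD('n)) * 2 ^ CARD('n) * (\<rho> powr a * q / (1 - q)))"
    proof (rule nn_integral_powr_shells_le[where r = "\<lambda>k. \<rho> / 2 ^ Suc k"])
      have "(\<rho> / 2 ^ Suc k) powr (real CARD('n) + p) = \<rho> powr a * q * q ^ k" for k
      proof -
        have "(\<rho> / 2 ^ Suc k) = \<rho> * 2 powr (- real (Suc k))"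
          by (simp add: powr_minus powr_realpow[symmetric] divide_inverse del: of_nat_Suc power_Suc)
        moreover have "(2 powr (- real (Suc k))) powr a = q ^ Suc k"
          unfolding q_def by (simp add: powr_powr powr_realpow[symmetric] mult_ac del: of_nat_Suc power_Suc)
        ultimately show ?thesis using \<rho> by (simp add: powr_mult a_def mult_ac)
      qed
      moreover have "(\<lambda>k. \<rho> powr a * q * q ^ k) sums (\<rho> powr a * q * (1 / (1 - q)))"
        using q by (intro sums_mult geometric_sums) auto
      ultimately show "(\<lambda>k. (\<rho> / 2 ^ Suc k) powr (real CARD('n) + p)) sums (\<rho> powr a * q / (1 - q))"
        by simp
    next
      fix y assume y: "y \<in> ball x \<rho>" "y \<noteq> x"
      then have pos: "0 < norm (x - y)" "norm (x - y) < \<rho>" by (auto simp: dist_norm)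
      then have "1 \<le> \<rho> / norm (x - y)" by simp
      then obtain k where k: "2 ^ k \<le> \<rho> / norm (x - y)" "\<rho> / norm (x - y) < 2 ^ Suc k"
        by (rule dyadic_index)
      \<comment> \<open>Half-open shells: a point at distance exactly \<open>\<rho> / 2 ^ k\<close> belongs to the preceding one.\<close>
      show "\<exists>k. \<rho> / 2 ^ Suc k \<le> norm (x - y) \<and> norm (x - y) < 2 * (\<rho> / 2 ^ Suc k)"
      proof (cases "norm (x - y) = \<rho> / 2 ^ k")
        case False
        then show ?thesis using k pos by (intro exI[of _ k]) (auto simp: field_simps)
      next
        case True
        then have "k \<noteq> 0" using pos by (auto intro: ccontr)
        then obtain j where j: "k = Suc j" by (cases k) auto
        have "0 < \<rho> / 2 ^ Suc j" using \<rho> by simp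
        then show ?thesis using True unfolding j by (intro exI[of _ j] conjI; linarith)
      qed
    qed (use \<rho> in auto)
    then show ?thesis by (simp add: C_def mult_ac)
  qed
  note B = set_integral_le_of_nn_integral[OF _ _ _ _ this]
  show ?thesis
  proof (rule that[OF C])
    show "set_integrable lebesgue (ball x \<rho>) (\<lambda>y. norm (x - y) powr p)" if "0 < \<rho>" for x :: "real ^ 'n" and \<rho>
      using C that by (intro B) auto
    show "(LINT y:ball x \<rho>|lebesgue. norm (x - y) powr p) \<le> C * \<rho> powr (real CARD('n) + p)"
      if "0 < \<rho>" for x :: "real ^ 'n" and \<rho>
      unfolding a_def[symmetric] using C that by (intro B) auto
  qed
qed

lemma powr_integral_tail:
  fixes p :: real
  assumes "real CARD('n::finite) + p < 0"
  obtains C where "0 \<le> C"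
    "\<And>(x::real ^ 'n) \<rho>. 0 < \<rho> \<Longrightarrow> set_integrable lebesgue (- ball x \<rho>) (\<lambda>y. norm (x - y) powr p)"
    "\<And>(x::real ^ 'n) \<rho>. 0 < \<rho> \<Longrightarrow>
        (LINT y:- ball x \<rho>|lebesgue. norm (x - y) powr p) \<le> C * \<rho> powr (real CARD('n) + p)"
proof -
  define a where "a = real CARD('n) + p"
  define q where "q = 2 powr a"
  define C where "C = 2 powr \<bar>p\<bar> * unit_ball_vol (real CARD('n)) * 2 ^ CARD('n) * (1 / (1 - q))"
  have q: "0 < q" "q < 1" using assms by (auto simp: q_def a_def powr_less_one)
  have C: "0 \<le> C" using q by (simp add: C_def)
  have "(\<integral>\<^sup>+y\<in>- ball x \<rho>. ennreal (norm (x - y) powr p) \<partial>lebesgue) \<le> ennreal (C * \<rho> powr a)"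
    if \<rho>: "0 < \<rho>" for x :: "real ^ 'n" and \<rho>
  proof -
    have "(\<integral>\<^sup>+y\<in>- ball x \<rho>. ennreal (norm (x - y) powr p) \<partial>lebesgue)
       \<le> ennreal (2 powr \<bar>p\<bar> * unit_ball_vol (real CARD('n)) * 2 ^ CARD('n) * (\<rho> powr a * (1 / (1 - q))))"
    proof (rule nn_integral_powr_shells_le[where r = "\<lambda>k. \<rho> * 2 ^ k"])
      have "(\<rho> * 2 ^ k) powr (real CARD('n) + p) = \<rho> powr a * q ^ k" for k
        using \<rho> unfolding q_def
        by (simp add: powr_mult a_def[symmetric] powr_powr powr_realpow[symmetric] mult_ac)
      moreover have "(\<lambda>k. \<rho> powr a * q ^ k) sums (\<rho> powr a * (1 / (1 - q)))"
        using q by (intro sums_mult geometric_sums) auto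
      ultimately show "(\<lambda>k. (\<rho> * 2 ^ k) powr (real CARD('n) + p)) sums (\<rho> powr a * (1 / (1 - q)))"
        by simp
    next
      fix y assume y: "y \<in> - ball x \<rho>" "y \<noteq> x"
      then have "1 \<le> norm (x - y) / \<rho>" using \<rho> by (auto simp: dist_norm)
      then obtain k where k: "2 ^ k \<le> norm (x - y) / \<rho>" "norm (x - y) / \<rho> < 2 ^ Suc k"
        by (rule dyadic_index)
      then show "\<exists>k. \<rho> * 2 ^ k \<le> norm (x - y) \<and> norm (x - y) < 2 * (\<rho> * 2 ^ k)"
        using \<rho> by (intro exI[of _ k]) (auto simp: field_simps)
    qed (use \<rho> in auto)
    then show ?thesis by (simp add: C_def mult_ac)
  qed
  note B = set_integral_le_of_nn_integral[OF _ _ _ _ this]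
  show ?thesis
  proof (rule that[OF C])
    show "set_integrable lebesgue (- ball x \<rho>) (\<lambda>y. norm (x - y) powr p)" if "0 < \<rho>" for x :: "real ^ 'n" and \<rho>
      using C that by (intro B) auto
    show "(LINT y:- ball x \<rho>|lebesgue. norm (x - y) powr p) \<le> C * \<rho> powr (real CARD('n) + p)"
      if "0 < \<rho>" for x :: "real ^ 'n" and \<rho>
      unfolding a_def[symmetric] using C that by (intro B) auto
  qed
qed

text \<open>The reflection in the point \<open>x\<close> preserves Lebesgue measure. This is the cancellation that removes
  the gradient term from a principal value.\<close>

lemma set_integral_point_reflection_odd:
  fixes f :: "'a::euclidean_space \<Rightarrow> real"
  assumes "f \<in> borel_measurable lebesgue" "A \<in> sets lebesgue"
    and A: "\<And>y. 2 *\<^sub>R x - y \<in> A \<longleftrightarrow> y \<in> A"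
    and odd: "\<And>y. y \<in> A \<Longrightarrow> f (2 *\<^sub>R x - y) = - f y"
  shows "(LINT y:A|lebesgue. f y) = 0"
proof -
  define T where "T = (\<lambda>y::'a. 2 *\<^sub>R x + (\<Sum>j\<in>Basis. (- 1 * (y \<bullet> j)) *\<^sub>R j))"
  have T: "T y = 2 *\<^sub>R x - y" for y
  proof -
    have "(\<Sum>j\<in>Basis. (- 1 * (y \<bullet> j)) *\<^sub>R j) = - (\<Sum>j\<in>Basis. (y \<bullet> j) *\<^sub>R j)"
      by (simp add: sum_negf)
    then show ?thesis by (simp add: T_def euclidean_representation)
  qed
  have leb: "lebesgue = distr lebesgue lebesgue T"
  proof -
    have "lebesgue = density (distr lebesgue lebesgue T) (\<lambda>_. ennreal (\<Prod>j\<in>(Basis::'a set). \<bar>- 1::real\<bar>))"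
      unfolding T_def by (rule lebesgue_affine_euclidean) auto
    also have "\<dots> = distr lebesgue lebesgue T" by (simp add: density_1)
    finally show ?thesis .
  qed
  have Tm[measurable]: "T \<in> lebesgue \<rightarrow>\<^sub>M lebesgue"
    unfolding T_def by (rule lebesgue_affine_measurable) auto
  have g[measurable]: "(\<lambda>y. indicator A y *\<^sub>R f y) \<in> borel_measurable lebesgue"
    using assms by measurable
  have "(LINT y:A|lebesgue. f y) = integral\<^sup>L (distr lebesgue lebesgue T) (\<lambda>y. indicator A y *\<^sub>R f y)"
    unfolding set_lebesgue_integral_def by (rule arg_cong2[where f = "integral\<^sup>L", OF leb refl])
  also have "\<dots> = (LINT y|lebesgue. indicator A (T y) *\<^sub>R f (T y))"
    by (rule integral_distr) measurable
  also have "\<dots> = (LINT y|lebesgue. - (indicator A y *\<^sub>R f y))"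
    by (intro Bochner_Integration.integral_cong refl) (auto simp: T A odd split: split_indicator)
  also have "\<dots> = - (LINT y:A|lebesgue. f y)"
    unfolding set_lebesgue_integral_def by simp
  finally show ?thesis by simp
qed

section \<open>The modified Bessel function and its kernel\<close>

lemma bessel_K_integrand_measurable [measurable]:
  "(\<lambda>t. exp (- r * cosh t) * cosh (\<nu> * t)) \<in> borel_measurable (lebesgue :: real measure)" for r \<nu> :: real
proof -
  have "(\<lambda>t. exp (- r * cosh t) * cosh (\<nu> * t)) \<in> borel_measurable borel"
    by (intro borel_measurable_continuous_onI continuous_intros)
  then show ?thesis by (intro measurable_completion) simp
qed

text \<open>From \<open>ln t \<le> t - 1\<close> at \<open>t = r / \<nu>\<close>.\<close>

lemma powr_le_exp: "r powr \<nu> \<le> \<nu> powr \<nu> * exp r" if "0 < \<nu>" "0 < r" for r \<nu> :: real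
proof -
  have "ln (r / \<nu>) \<le> r / \<nu> - 1" using that by (intro ln_le_minus_one) auto
  then have "ln r \<le> ln \<nu> + r / \<nu> - 1" using that by (simp add: ln_div)
  then have "\<nu> * ln r \<le> \<nu> * (ln \<nu> + r / \<nu> - 1)" using that by (intro mult_left_mono) auto
  also have "\<dots> \<le> \<nu> * ln \<nu> + r" using that by (simp add: algebra_simps)
  finally show ?thesis using that by (simp add: powr_def exp_add[symmetric])
qed

text \<open>Comparability near \<open>0\<close> is given. It also yields the convergence of the defining integral, after which
  \<open>cosh t \<ge> 1\<close> gives the decay \<open>K(r) \<le> exp (r0 - r) K(r0)\<close>; hence the upper bound by a
  multiple of \<open>r powr (- \<nu>)\<close> extends to all positive \<open>r\<close>. A power bound at infinity suffices for
  what follows, because the resulting kernel is already integrable there.\<close>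

lemma bessel_K_comparison:
  assumes "bessel_comparison_radius \<nu> r0" and \<nu>: "0 < \<nu>"
  obtains c0 C1 where "0 < c0" "0 < C1"
    "\<And>r. 0 < r \<Longrightarrow> r \<le> r0 \<Longrightarrow> c0 * r powr (- \<nu>) \<le> bessel_K \<nu> r"
    "\<And>r. 0 < r \<Longrightarrow> bessel_K \<nu> r \<le> C1 * r powr (- \<nu>)"
    "\<And>r. 0 < r \<Longrightarrow> 0 < bessel_K \<nu> r"
    "\<And>r r'. 0 < r \<Longrightarrow> r \<le> r' \<Longrightarrow> bessel_K \<nu> r' \<le> bessel_K \<nu> r"
proof -
  obtain c0 C0 where r0: "0 < r0" and c0: "0 < c0" "c0 < C0"
    and low: "\<And>r. 0 < r \<Longrightarrow> r \<le> r0 \<Longrightarrow> c0 * r powr (- \<nu>) \<le> bessel_K \<nu> r"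
    and up: "\<And>r. 0 < r \<Longrightarrow> r \<le> r0 \<Longrightarrow> bessel_K \<nu> r \<le> C0 * r powr (- \<nu>)"
    using assms unfolding bessel_comparison_radius_def by blast
  let ?f = "\<lambda>r t. exp (- r * cosh t) * cosh (\<nu> * t)"
  have f_mono: "?f r' t \<le> ?f r t" if "r \<le> r'" for r r' t :: real
    using that by (auto intro!: mult_right_mono mult_left_mono cosh_real_nonneg)
  \<comment> \<open>A divergent Bochner integral has the value 0, which the lower bound excludes.\<close>
  have int_small: "set_integrable lebesgue {0..} (?f r)" if "0 < r" "r \<le> r0" for r
  proof (rule ccontr)
    assume "\<not> set_integrable lebesgue {0..} (?f r)"
    then have "bessel_K \<nu> r = 0"
      by (simp add: bessel_K_def set_lebesgue_integral_def set_integrable_def not_integrable_integral_eq)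
    moreover have "0 < c0 * r powr (- \<nu>)" using c0 that by simp
    ultimately show False using low[OF that] by simp
  qed
  have int: "set_integrable lebesgue {0..} (?f r)" if "0 < r" for r
  proof (cases "r \<le> r0")
    case False
    have "norm (?f r t) \<le> norm (?f r0 t)" for t
      using f_mono[of r0 r t] False by simp
    moreover have "set_borel_measurable lebesgue {0..} (?f r)"
      unfolding set_borel_measurable_def
      by (intro borel_measurable_scaleR borel_measurable_indicator bessel_K_integrand_measurable) auto
    ultimately show ?thesis
      by (intro set_integrable_bound[OF int_small[OF r0 order_refl]]) simp_all
  qed (use int_small that in auto)
  have anti: "bessel_K \<nu> r' \<le> bessel_K \<nu> r" if "0 < r" "r \<le> r'" for r r'
    unfolding bessel_K_def using that f_mono by (intro set_integral_mono int) auto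
  have pos: "0 < bessel_K \<nu> r" if "0 < r" for r
  proof -
    have "0 < exp (- r * cosh 1) * measure lebesgue {0..1::real}" by simp
    also have "\<dots> = (LINT t|lebesgue. exp (- r * cosh 1) * indicator {0..1::real} t)"
      by simp
    also have "\<dots> \<le> (LINT t|lebesgue. indicator {0..} t *\<^sub>R ?f r t)"
    proof (rule integral_mono)
      show "integrable lebesgue (\<lambda>t. exp (- r * cosh 1) * indicator {0..1::real} t)"
        by (intro integrable_mult_right integrable_real_indicator) auto
      show "integrable lebesgue (\<lambda>t. indicator {0..} t *\<^sub>R ?f r t)"
        using int[OF that] by (simp add: set_integrable_def)
      have "exp (- r * cosh 1) * 1 \<le> ?f r t" if "0 \<le> t" "t \<le> 1" for t
        using that \<open>0 < r\<close> by (intro mult_mono) (auto simp: cosh_real_nonneg_le_iff cosh_real_ge_1)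
      then show "exp (- r * cosh 1) * indicator {0..1} t \<le> indicator {0..} t *\<^sub>R ?f r t" for t
        by (auto split: split_indicator)
    qed
    also have "\<dots> = bessel_K \<nu> r"
      by (simp add: bessel_K_def set_lebesgue_integral_def)
    finally show ?thesis .
  qed
  have decay: "bessel_K \<nu> r \<le> exp (- (r - r0)) * bessel_K \<nu> r0" if "r0 \<le> r" for r
  proof -
    have "?f r t \<le> exp (- (r - r0)) * ?f r0 t" for t
    proof -
      have "(r - r0) * 1 \<le> (r - r0) * cosh t"
        using that by (intro mult_left_mono) (auto simp: cosh_real_ge_1)
      then have "exp (- r * cosh t) \<le> exp (- (r - r0)) * exp (- r0 * cosh t)"
        by (simp add: exp_add[symmetric] algebra_simps)
      then have "exp (- r * cosh t) * cosh (\<nu> * t) \<le> (exp (- (r - r0)) * exp (- r0 * cosh t)) * cosh (\<nu> * t)"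
        by (intro mult_right_mono) auto
      then show ?thesis by (simp only: mult.assoc)
    qed
    then have "bessel_K \<nu> r \<le> (LINT t:{0..}|lebesgue. exp (- (r - r0)) * ?f r0 t)"
      unfolding bessel_K_def using that r0
      by (intro set_integral_mono int set_integrable_mult_right) auto
    also have "\<dots> = exp (- (r - r0)) * bessel_K \<nu> r0"
      unfolding bessel_K_def by simp
    finally show ?thesis .
  qed
  define C1 where "C1 = max C0 (exp r0 * bessel_K \<nu> r0 * \<nu> powr \<nu>)"
  have glob: "bessel_K \<nu> r \<le> C1 * r powr (- \<nu>)" if "0 < r" for r
  proof (cases "r \<le> r0")
    case True
    have "bessel_K \<nu> r \<le> C0 * r powr (- \<nu>)" using up that True by blast
    also have "\<dots> \<le> C1 * r powr (- \<nu>)" by (intro mult_right_mono) (auto simp: C1_def)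
    finally show ?thesis .
  next
    case False
    have "exp (- r) * r powr \<nu> \<le> exp (- r) * (\<nu> powr \<nu> * exp r)"
      using powr_le_exp[OF \<nu> that] by (intro mult_left_mono) auto
    also have "\<dots> = \<nu> powr \<nu>" by (simp add: exp_minus)
    finally have "exp (- r) * r powr \<nu> * r powr (- \<nu>) \<le> \<nu> powr \<nu> * r powr (- \<nu>)"
      by (intro mult_right_mono) auto
    then have e: "exp (- r) \<le> \<nu> powr \<nu> * r powr (- \<nu>)"
      using that by (simp add: mult.assoc powr_add[symmetric])
    have "bessel_K \<nu> r \<le> exp (- r) * (exp r0 * bessel_K \<nu> r0)"
      using decay[of r] False by (simp add: exp_diff exp_minus divide_inverse mult_ac)
    also have "\<dots> \<le> (\<nu> powr \<nu> * r powr (- \<nu>)) * (exp r0 * bessel_K \<nu> r0)"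
      using pos[OF r0] by (intro mult_right_mono e) auto
    also have "\<dots> = (exp r0 * bessel_K \<nu> r0 * \<nu> powr \<nu>) * r powr (- \<nu>)" by (simp add: mult_ac)
    also have "\<dots> \<le> C1 * r powr (- \<nu>)" by (intro mult_right_mono) (auto simp: C1_def)
    finally show ?thesis .
  qed
  have "0 < C1" using c0 by (simp add: C1_def)
  show ?thesis by (rule that[OF c0(1) \<open>0 < C1\<close> low glob pos anti])
qed

lemma bessel_kernel_point_reflection: "bessel_kernel m s x (2 *\<^sub>R x - y) = bessel_kernel m s x y"
proof -
  have "x - (2 *\<^sub>R x - y) = y - x" by (simp add: scaleR_2)
  then show ?thesis
    unfolding bessel_kernel_def by (simp only: norm_minus_commute[of y x])
qed

text \<open>Monotonicity of \<open>K\<close> spares a joint measurability argument for its integral representation.\<close>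

lemma bessel_kernel_measurable:
  fixes x :: "real ^ 'n"
  assumes anti: "\<And>r r'. 0 < r \<Longrightarrow> r \<le> r' \<Longrightarrow> bessel_K (real CARD('n) / 2 + s) r' \<le> bessel_K (real CARD('n) / 2 + s) r"
    and m: "0 < m"
  shows "bessel_kernel m s x \<in> borel_measurable lebesgue"
proof -
  let ?\<nu> = "real CARD('n) / 2 + s"
  have "(\<lambda>r. - bessel_K ?\<nu> r) \<in> borel_measurable (restrict_space borel {0<..})"
    by (intro borel_measurable_mono_on_fnc mono_onI) (auto intro: anti)
  then have "(\<lambda>r. - (- bessel_K ?\<nu> r)) \<in> borel_measurable (restrict_space borel {0<..})"
    by (rule borel_measurable_uminus)
  then have [measurable]: "(\<lambda>r. if r \<in> {0<..} then bessel_K ?\<nu> r else 0) \<in> borel_measurable borel"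
    by (subst measurable_If_restrict_space_iff) (auto simp: greaterThan_def)
  have eq: "bessel_kernel m s x =
     (\<lambda>y. (if m * norm (x - y) \<in> {0<..} then bessel_K ?\<nu> (m * norm (x - y)) else 0)
          / norm (x - y) powr ?\<nu>)"
    using m by (auto simp: bessel_kernel_def fun_eq_iff zero_less_mult_iff)
  have "(\<lambda>y. (if m * norm (x - y) \<in> {0<..} then bessel_K ?\<nu> (m * norm (x - y)) else 0))
     = (\<lambda>r. if r \<in> {0<..} then bessel_K ?\<nu> r else 0) \<circ> (\<lambda>y. m * norm (x - y))"
    by auto
  also have "\<dots> \<in> borel_measurable borel"
    by (rule measurable_comp[of _ _ borel]) measurable
  finally show ?thesis
    unfolding eq by (intro measurable_completion borel_measurable_divide) auto
qed

section \<open>Principal values of singular integrals\<close>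

text \<open>Principal values are studied for an arbitrary symmetric kernel of order \<open>2s\<close>. The upper
  bound gives a finite tail and a finite second moment, the symmetry cancels linear terms.\<close>

locale singular_kernel =
  fixes \<kappa> :: "real ^ 'n \<Rightarrow> real ^ 'n \<Rightarrow> real" and s \<Lambda> :: real
  assumes s: "0 < s" "s < 1"
    and measurable_kernel [measurable]: "\<And>x. \<kappa> x \<in> borel_measurable lebesgue"
    and kernel_nonneg: "\<And>x y. 0 \<le> \<kappa> x y"
    and kernel_le: "\<And>x y. \<kappa> x y \<le> \<Lambda> * norm (x - y) powr (- (real CARD('n) + 2 * s))"
    and kernel_symmetric: "\<And>x y. \<kappa> x (2 *\<^sub>R x - y) = \<kappa> x y"
    and \<Lambda>: "0 < \<Lambda>"
begin

definition trunc :: "(real ^ 'n \<Rightarrow> real) \<Rightarrow> real ^ 'n \<Rightarrow> real \<Rightarrow> real" where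
  "trunc u x \<eta> = (LINT y:{y. \<eta> \<le> norm (x - y)}|lebesgue. (u x - u y) * \<kappa> x y)"

lemma outside_ball: "{y. \<eta> \<le> norm (x - y)} = - ball x \<eta>" for x :: "real ^ 'n"
  by (auto simp: dist_norm)

lemma kernel_tail:
  obtains C where "0 \<le> C"
    "\<And>x \<rho>. 0 < \<rho> \<Longrightarrow> set_integrable lebesgue (- ball x \<rho>) (\<kappa> x)"
    "\<And>x \<rho>. 0 < \<rho> \<Longrightarrow> (LINT y:- ball x \<rho>|lebesgue. \<kappa> x y) \<le> C * \<Lambda> * \<rho> powr (- (2 * s))"
proof -
  let ?p = "- (real CARD('n) + 2 * s)"
  obtain C where C: "0 \<le> C"
    and i: "\<And>(x::real^'n) \<rho>. 0 < \<rho> \<Longrightarrow> set_integrable lebesgue (- ball x \<rho>) (\<lambda>y. norm (x - y) powr ?p)"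
    and le: "\<And>(x::real^'n) \<rho>. 0 < \<rho> \<Longrightarrow>
        (LINT y:- ball x \<rho>|lebesgue. norm (x - y) powr ?p) \<le> C * \<rho> powr (real CARD('n) + ?p)"
    using powr_integral_tail[where 'n = 'n and p = ?p] s by auto
  have int: "set_integrable lebesgue (- ball x \<rho>) (\<kappa> x)" if "0 < \<rho>" for x \<rho>
    using \<Lambda> kernel_le kernel_nonneg
    by (intro set_integrable_dominated[OF set_integrable_mult_right[where a = \<Lambda>, OF i[OF that]]]) auto
  show ?thesis
  proof (rule that[OF C int])
    show "(LINT y:- ball x \<rho>|lebesgue. \<kappa> x y) \<le> C * \<Lambda> * \<rho> powr (- (2 * s))" if "0 < \<rho>" for x \<rho>
    proof -
      have "(LINT y:- ball x \<rho>|lebesgue. \<kappa> x y) \<le> (LINT y:- ball x \<rho>|lebesgue. \<Lambda> * norm (x - y) powr ?p)"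
        using \<Lambda> kernel_le by (intro set_integral_mono int that set_integrable_mult_right i) auto
      also have "\<dots> \<le> \<Lambda> * (C * \<rho> powr (real CARD('n) + ?p))"
        using le[OF that, of x] \<Lambda> by simp
      finally show ?thesis by (simp add: mult_ac)
    qed
  qed
qed

text \<open>The quadratic weight compensates the singularity because \<open>s < 1\<close>.\<close>

lemma kernel_second_moment:
  obtains C where "0 \<le> C"
    "\<And>x \<rho>. 0 < \<rho> \<Longrightarrow> set_integrable lebesgue (ball x \<rho>) (\<lambda>y. (norm (x - y))\<^sup>2 * \<kappa> x y)"
    "\<And>x \<rho>. 0 < \<rho> \<Longrightarrow> (LINT y:ball x \<rho>|lebesgue. (norm (x - y))\<^sup>2 * \<kappa> x y) \<le> C * \<Lambda> * \<rho> powr (2 - 2 * s)"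
proof -
  let ?q = "- (real CARD('n) + 2 * s)"
  let ?p = "2 - (real CARD('n) + 2 * s)"
  obtain C where C: "0 \<le> C"
    and i: "\<And>(x::real^'n) \<rho>. 0 < \<rho> \<Longrightarrow> set_integrable lebesgue (ball x \<rho>) (\<lambda>y. norm (x - y) powr ?p)"
    and le: "\<And>(x::real^'n) \<rho>. 0 < \<rho> \<Longrightarrow>
        (LINT y:ball x \<rho>|lebesgue. norm (x - y) powr ?p) \<le> C * \<rho> powr (real CARD('n) + ?p)"
    using powr_integral_ball[where 'n = 'n and p = ?p] s by auto
  have [measurable]: "(\<lambda>y. (norm (x - y))\<^sup>2) \<in> borel_measurable lebesgue" for x :: "real ^ 'n"
    by (rule measurable_completion) measurable
  have pt: "(norm (x - y))\<^sup>2 * \<kappa> x y \<le> \<Lambda> * norm (x - y) powr ?p" for x y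
  proof (cases "x = y")
    case False
    have "(norm (x - y))\<^sup>2 * \<kappa> x y \<le> (norm (x - y))\<^sup>2 * (\<Lambda> * norm (x - y) powr ?q)"
      by (intro mult_left_mono kernel_le) auto
    also have "\<dots> = \<Lambda> * (norm (x - y) powr 2 * norm (x - y) powr ?q)"
      using False by (simp add: powr_numeral)
    also have "\<dots> = \<Lambda> * norm (x - y) powr ?p"
      unfolding powr_add[symmetric] by (simp add: algebra_simps)
    finally show ?thesis .
  qed auto
  have int: "set_integrable lebesgue (ball x \<rho>) (\<lambda>y. (norm (x - y))\<^sup>2 * \<kappa> x y)" if "0 < \<rho>" for x \<rho>
    using \<Lambda> pt kernel_nonneg
    by (intro set_integrable_dominated[OF set_integrable_mult_right[where a = \<Lambda>, OF i[OF that]]]) auto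
  show ?thesis
  proof (rule that[OF C int])
    show "(LINT y:ball x \<rho>|lebesgue. (norm (x - y))\<^sup>2 * \<kappa> x y) \<le> C * \<Lambda> * \<rho> powr (2 - 2 * s)"
      if "0 < \<rho>" for x \<rho>
    proof -
      have "(LINT y:ball x \<rho>|lebesgue. (norm (x - y))\<^sup>2 * \<kappa> x y)
         \<le> (LINT y:ball x \<rho>|lebesgue. \<Lambda> * norm (x - y) powr ?p)"
        using \<Lambda> pt by (intro set_integral_mono int that set_integrable_mult_right i) auto
      also have "\<dots> \<le> \<Lambda> * (C * \<rho> powr (real CARD('n) + ?p))"
        using le[OF that, of x] \<Lambda> by simp
      finally show ?thesis by (simp add: mult_ac)
    qed
  qed
qed

text \<open>Linear terms are invisible to integrals over annuli around \<open>x\<close>.\<close>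

lemma linear_part_integral:
  assumes "0 < \<eta>"
  shows "set_integrable lebesgue (ball x \<rho> - ball x \<eta>) (\<lambda>y. (a \<bullet> (y - x)) * \<kappa> x y)"
    and "(LINT y:ball x \<rho> - ball x \<eta>|lebesgue. (a \<bullet> (y - x)) * \<kappa> x y) = 0"
proof -
  have [measurable]: "(\<lambda>y. a \<bullet> (y - x)) \<in> borel_measurable lebesgue"
    by (rule measurable_completion) measurable
  have meas: "ball x \<rho> - ball x \<eta> \<in> sets lebesgue" by auto
  have "set_integrable lebesgue (ball x \<rho> - ball x \<eta>) (\<kappa> x)"
    using kernel_tail assms by (metis Diff_eq inf_le2 meas set_integrable_subset)
  then have "set_integrable lebesgue (ball x \<rho> - ball x \<eta>) (\<lambda>y. (norm a * \<bar>\<rho>\<bar>) * \<kappa> x y)"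
    by (rule set_integrable_mult_right)
  then show "set_integrable lebesgue (ball x \<rho> - ball x \<eta>) (\<lambda>y. (a \<bullet> (y - x)) * \<kappa> x y)"
  proof (rule set_integrable_dominated)
    show "(\<lambda>y. (a \<bullet> (y - x)) * \<kappa> x y) \<in> borel_measurable lebesgue" by measurable
    fix y assume y: "y \<in> ball x \<rho> - ball x \<eta>"
    have "\<bar>a \<bullet> (y - x)\<bar> \<le> norm a * norm (y - x)" by (rule Cauchy_Schwarz_ineq2)
    also have "\<dots> \<le> norm a * \<bar>\<rho>\<bar>"
      using y by (intro mult_left_mono) (auto simp: dist_norm norm_minus_commute)
    finally have "\<bar>a \<bullet> (y - x)\<bar> * \<kappa> x y \<le> (norm a * \<bar>\<rho>\<bar>) * \<kappa> x y"
      by (rule mult_right_mono) (rule kernel_nonneg)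
    then show "\<bar>(a \<bullet> (y - x)) * \<kappa> x y\<bar> \<le> (norm a * \<bar>\<rho>\<bar>) * \<kappa> x y"
      using kernel_nonneg[of x y] by (simp add: abs_mult)
  qed (rule meas)
  have nrm: "dist x (2 *\<^sub>R x - y) = dist x y" for y
    by (simp add: dist_norm norm_minus_commute scaleR_2)
  show "(LINT y:ball x \<rho> - ball x \<eta>|lebesgue. (a \<bullet> (y - x)) * \<kappa> x y) = 0"
  proof (rule set_integral_point_reflection_odd[where x = x])
    show "(\<lambda>y. (a \<bullet> (y - x)) * \<kappa> x y) \<in> borel_measurable lebesgue" by measurable
    show "2 *\<^sub>R x - y \<in> ball x \<rho> - ball x \<eta> \<longleftrightarrow> y \<in> ball x \<rho> - ball x \<eta>" for y
      by (simp add: nrm)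
    show "(a \<bullet> (2 *\<^sub>R x - y - x)) * \<kappa> x (2 *\<^sub>R x - y) = - ((a \<bullet> (y - x)) * \<kappa> x y)" for y
      by (simp add: kernel_symmetric inner_diff_right algebra_simps)
  qed (rule meas)
qed

lemma trunc_split:
  assumes "0 < \<eta>" "\<eta> \<le> \<rho>"
    and int: "set_integrable lebesgue (- ball x \<eta>) (\<lambda>y. (u x - u y) * \<kappa> x y)"
  shows "trunc u x \<eta> = (LINT y:ball x \<rho> - ball x \<eta>|lebesgue. (u x - u y) * \<kappa> x y) + trunc u x \<rho>"
    and "set_integrable lebesgue (ball x \<rho> - ball x \<eta>) (\<lambda>y. (u x - u y) * \<kappa> x y)"
    and "set_integrable lebesgue (- ball x \<rho>) (\<lambda>y. (u x - u y) * \<kappa> x y)"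
proof -
  show 1: "set_integrable lebesgue (ball x \<rho> - ball x \<eta>) (\<lambda>y. (u x - u y) * \<kappa> x y)"
    by (rule set_integrable_subset[OF int]) auto
  show 2: "set_integrable lebesgue (- ball x \<rho>) (\<lambda>y. (u x - u y) * \<kappa> x y)"
    by (rule set_integrable_subset[OF int]) (use assms in auto)
  have "- ball x \<eta> = (ball x \<rho> - ball x \<eta>) \<union> (- ball x \<rho>)" using assms by auto
  then show "trunc u x \<eta> = (LINT y:ball x \<rho> - ball x \<eta>|lebesgue. (u x - u y) * \<kappa> x y) + trunc u x \<rho>"
    
    unfolding trunc_def outside_ball using set_integral_Un[OF _ 1 2] assms(2) by auto
qed

text \<open>Subtracting the linear part from the increment leaves a function \<open>G\<close> that is absolutely integrable near
  \<open>x\<close>. The truncated integrals therefore differ from a constant by the integral of \<open>G\<close> over a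
  shrinking ball, which tends to \<open>0\<close>.\<close>

lemma principal_value_converges:
  assumes [measurable]: "u \<in> borel_measurable lebesgue"
    and int: "\<And>\<eta>. 0 < \<eta> \<Longrightarrow> set_integrable lebesgue (- ball x \<eta>) (\<lambda>y. (u x - u y) * \<kappa> x y)"
    and \<delta>: "0 < \<delta>" and L: "0 < L"
    and quad: "\<And>y. y \<in> ball x \<delta> \<Longrightarrow> \<bar>u x - u y + a \<bullet> (y - x)\<bar> \<le> L * (norm (x - y))\<^sup>2"
  obtains l where "(trunc u x \<longlongrightarrow> l) (at_right 0)"
proof -
  define G where "G = (\<lambda>y. (u x - u y + a \<bullet> (y - x)) * \<kappa> x y)"
  have [measurable]: "(\<lambda>y. a \<bullet> (y - x)) \<in> borel_measurable lebesgue"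
    by (rule measurable_completion) measurable
  have [measurable]: "G \<in> borel_measurable lebesgue" unfolding G_def by measurable
  obtain C where C: "0 \<le> C"
    and i: "\<And>x \<rho>. 0 < \<rho> \<Longrightarrow> set_integrable lebesgue (ball x \<rho>) (\<lambda>y. (norm (x - y))\<^sup>2 * \<kappa> x y)"
    and le: "\<And>x \<rho>. 0 < \<rho> \<Longrightarrow> (LINT y:ball x \<rho>|lebesgue. (norm (x - y))\<^sup>2 * \<kappa> x y) \<le> C * \<Lambda> * \<rho> powr (2 - 2 * s)"
    by (rule kernel_second_moment) blast
  have G_le: "\<bar>G y\<bar> \<le> L * ((norm (x - y))\<^sup>2 * \<kappa> x y)" if "y \<in> ball x \<delta>" for y
    using mult_right_mono[OF quad[OF that] kernel_nonneg[of x y]] kernel_nonneg[of x y]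
    by (simp add: G_def abs_mult mult_ac)
  have G_int: "set_integrable lebesgue (ball x \<eta>) G" if "0 < \<eta>" "\<eta> \<le> \<delta>" for \<eta>
    using that G_le
    by (intro set_integrable_dominated[OF set_integrable_mult_right[where a = L, OF i[OF that(1)]]]) auto
  have G_small: "\<bar>LINT y:ball x \<eta>|lebesgue. G y\<bar> \<le> L * C * \<Lambda> * \<eta> powr (2 - 2 * s)"
    if "0 < \<eta>" "\<eta> \<le> \<delta>" for \<eta>
  proof -
    have "\<bar>LINT y:ball x \<eta>|lebesgue. G y\<bar> \<le> (LINT y:ball x \<eta>|lebesgue. \<bar>G y\<bar>)"
      using set_integral_norm_bound[OF G_int[OF that]] by simp
    also have "\<dots> \<le> (LINT y:ball x \<eta>|lebesgue. L * ((norm (x - y))\<^sup>2 * \<kappa> x y))"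
      using G_le that L by (intro set_integral_mono set_integrable_mult_right i set_integrable_abs G_int) auto
    also have "\<dots> \<le> L * (C * \<Lambda> * \<eta> powr (2 - 2 * s))"
      using le[OF that(1), of x] L by simp
    finally show ?thesis by (simp add: mult_ac)
  qed
  have trunc_eq: "trunc u x \<eta> = trunc u x \<delta> + (LINT y:ball x \<delta>|lebesgue. G y) - (LINT y:ball x \<eta>|lebesgue. G y)"
    if "0 < \<eta>" "\<eta> \<le> \<delta>" for \<eta>
  proof -
    let ?A = "ball x \<delta> - ball x \<eta>"
    note sp = trunc_split[OF that int[OF that(1)]]
    have GA: "set_integrable lebesgue ?A G"
      by (rule set_integrable_subset[OF G_int[OF \<delta> order_refl]]) auto
    have "(LINT y:?A|lebesgue. G y)
       = (LINT y:?A|lebesgue. (u x - u y) * \<kappa> x y) + (LINT y:?A|lebesgue. (a \<bullet> (y - x)) * \<kappa> x y)"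
      unfolding G_def distrib_right by (rule set_integral_add(2)[OF sp(2) linear_part_integral(1)[OF that(1)]])
    moreover have "ball x \<delta> = ball x \<eta> \<union> ?A" using that by auto
    then have "(LINT y:ball x \<delta>|lebesgue. G y) = (LINT y:ball x \<eta>|lebesgue. G y) + (LINT y:?A|lebesgue. G y)"
      using set_integral_Un[of "ball x \<eta>" ?A lebesgue G] G_int[OF that] GA by auto
    ultimately show ?thesis using sp(1) linear_part_integral(2)[OF that(1), of x \<delta> a] by simp
  qed
  have "((\<lambda>\<eta>. LINT y:ball x \<eta>|lebesgue. G y) \<longlongrightarrow> 0) (at_right 0)"
  proof (rule Lim_null_comparison)
    show "\<forall>\<^sub>F \<eta> in at_right 0. norm (LINT y:ball x \<eta>|lebesgue. G y) \<le> L * C * \<Lambda> * \<eta> powr (2 - 2 * s)"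
      using \<delta> by (auto simp: eventually_at_right_field intro!: exI[of _ \<delta>] G_small)
    have "((\<lambda>\<eta>. L * C * \<Lambda> * \<eta> powr (2 - 2 * s)) \<longlongrightarrow> L * C * \<Lambda> * 0 powr (2 - 2 * s)) (at_right 0)"
      using s by (intro tendsto_mult tendsto_const tendsto_powr' tendsto_ident_at)
        (auto simp: eventually_at_right_field intro!: exI[of _ 1])
    then show "((\<lambda>\<eta>. L * C * \<Lambda> * \<eta> powr (2 - 2 * s)) \<longlongrightarrow> 0) (at_right 0)" by simp
  qed
  then have lim: "((\<lambda>\<eta>. trunc u x \<delta> + (LINT y:ball x \<delta>|lebesgue. G y) - (LINT y:ball x \<eta>|lebesgue. G y))
      \<longlongrightarrow> trunc u x \<delta> + (LINT y:ball x \<delta>|lebesgue. G y) - 0) (at_right 0)"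
    by (intro tendsto_diff tendsto_const)
  have "\<forall>\<^sub>F \<eta> in at_right 0.
      trunc u x \<delta> + (LINT y:ball x \<delta>|lebesgue. G y) - (LINT y:ball x \<eta>|lebesgue. G y) = trunc u x \<eta>"
  proof (rule eventually_at_rightI[OF _ \<delta>])
    fix \<eta> assume "\<eta> \<in> {0<..<\<delta>}"
    then show "trunc u x \<delta> + (LINT y:ball x \<delta>|lebesgue. G y) - (LINT y:ball x \<eta>|lebesgue. G y) = trunc u x \<eta>"
      using trunc_eq[of \<eta>] by simp
  qed
  note Lim_transform_eventually[OF lim this]
  then show ?thesis by (rule that)
qed

end

section \<open>Regular functions and paraboloids touching from below\<close>

text \<open>A Lipschitz gradient bounds the remainder of the first order Taylor expansion.\<close>

lemma C11_loc_quadratic: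
  fixes u :: "real ^ 'n \<Rightarrow> real"
  assumes u: "u \<in> C11_loc D" and D: "open D" and x: "x \<in> D"
  obtains a L \<delta> where "0 < L" "0 < \<delta>"
    "\<And>y. y \<in> ball x \<delta> \<Longrightarrow> \<bar>u x - u y + a \<bullet> (y - x)\<bar> \<le> L * (norm (x - y))\<^sup>2"
proof -
  obtain g where g: "\<forall>x\<in>D. GDERIV u x :> g x"
    and lip: "\<forall>x\<in>D. \<exists>e>0. \<exists>L. L-lipschitz_on (ball x e \<inter> D) g"
    using u unfolding C11_loc_def by blast
  obtain e L where e: "0 < e" and L: "L-lipschitz_on (ball x e \<inter> D) g" using lip x by blast
  obtain d where d: "0 < d" "ball x d \<subseteq> D" using D x open_contains_ball by blast
  define \<delta> where "\<delta> = min e d"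
  have \<delta>: "0 < \<delta>" "ball x \<delta> \<subseteq> D" "ball x \<delta> \<subseteq> ball x e" using d e by (auto simp: \<delta>_def)
  show ?thesis
  proof (rule that[of "L + 1" \<delta> "g x"])
    show "0 < L + 1" using lipschitz_on_nonneg[OF L] by simp
    show "0 < \<delta>" by (rule \<delta>)
    fix y assume y: "y \<in> ball x \<delta>"
    let ?S = "cball x (norm (y - x))"
    have S: "?S \<subseteq> ball x e \<inter> D" using y \<delta> by (force simp: dist_norm norm_minus_commute)
    have "norm (u y - u x - (\<lambda>h. h \<bullet> g x) (y - x)) \<le> norm (y - x) * (L * norm (y - x))"
    proof (rule differentiable_bound_linearization[where S = ?S and f' = "\<lambda>v h. h \<bullet> g v"])
      show "x + t *\<^sub>R (y - x) \<in> ?S" if "t \<in> {0..1}" for t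
        using that by (simp add: dist_norm mult_left_le_one_le)
      show "(u has_derivative (\<lambda>h. h \<bullet> g v)) (at v within ?S)" if "v \<in> ?S" for v
        
      proof -
        have "GDERIV u v :> g v" using g that S by blast
        then show ?thesis unfolding gderiv_def by (rule has_derivative_at_withinI)
      qed
      show "onorm ((\<lambda>h. h \<bullet> g v) - (\<lambda>h. h \<bullet> g x)) \<le> L * norm (y - x)" if v: "v \<in> ?S" for v
      proof -
        have "onorm (\<lambda>h. h \<bullet> (g v - g x)) \<le> norm (g v - g x)"
          by (rule onorm_le) (metis Cauchy_Schwarz_ineq2 mult.commute real_norm_def)
        also have "\<dots> \<le> L * dist v x"
        proof -
          have "v \<in> ball x e \<inter> D" "x \<in> ball x e \<inter> D" using S v x e by auto
          then show ?thesis using lipschitz_onD[OF L, of v x] by (simp add: dist_norm)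
        qed
        also have "\<dots> \<le> L * norm (y - x)"
          using v lipschitz_on_nonneg[OF L] by (intro mult_left_mono) (auto simp: dist_commute)
        finally show ?thesis by (simp add: fun_diff_def inner_diff_right)
      qed
    qed simp
    then have "\<bar>u y - u x - (y - x) \<bullet> g x\<bar> \<le> L * (norm (x - y))\<^sup>2"
      by (simp add: power2_eq_square norm_minus_commute mult_ac)
    moreover have "\<bar>u x - u y + g x \<bullet> (y - x)\<bar> = \<bar>u y - u x - (y - x) \<bullet> g x\<bar>"
      by (subst inner_commute) linarith
    moreover have "L * (norm (x - y))\<^sup>2 \<le> (L + 1) * (norm (x - y))\<^sup>2"
      by (intro mult_right_mono) auto
    ultimately show "\<bar>u x - u y + g x \<bullet> (y - x)\<bar> \<le> (L + 1) * (norm (x - y))\<^sup>2" by linarith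
  qed
qed

lemma C11_loc_continuous_on:
  fixes u :: "real ^ 'n \<Rightarrow> real"
  assumes "u \<in> C11_loc D"
  shows "continuous_on D u"
proof (rule continuous_at_imp_continuous_on, rule ballI)
  fix x assume "x \<in> D"
  then obtain a where "GDERIV u x :> a" using assms by (auto simp: C11_loc_def)
  then show "isCont u x" unfolding gderiv_def by (rule has_derivative_continuous)
qed

text \<open>A substitute for a minimum point of a function that need not attain its infimum: \<open>x\<close> minimises \<open>w\<close>
  up to \<open>\<epsilon>\<close>, and \<open>w\<close> plus the paraboloid \<open>\<epsilon> |y - x|\<^sup>2 / \<rho>\<^sup>2\<close> attains its minimum over the ball at
  \<open>z\<close>. Outside the ball the paraboloid is at least \<open>\<epsilon>\<close>, so the minimum is global. Expanding the square
  around \<open>z\<close> leaves a pure quadratic and a linear term.\<close>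

lemma touching_paraboloid:
  fixes w :: "'a::euclidean_space \<Rightarrow> real"
  assumes cont: "continuous_on (cball x \<rho>) w" and \<rho>: "0 < \<rho>" and \<epsilon>: "0 \<le> \<epsilon>"
    and low: "\<And>y. w x - \<epsilon> \<le> w y"
  obtains z a where "dist x z \<le> \<rho>" "w z \<le> w x"
    "\<And>y. w z - w y \<le> \<epsilon> / \<rho>\<^sup>2 * (norm (z - y))\<^sup>2 + a \<bullet> (y - z)"
proof -
  let ?k = "\<epsilon> / \<rho>\<^sup>2"
  have k: "0 \<le> ?k" using \<epsilon> by simp
  have "continuous_on (cball x \<rho>) (\<lambda>y. w y + ?k * (norm (y - x))\<^sup>2)"
    by (intro continuous_intros cont)
  moreover have "cball x \<rho> \<noteq> {}" using \<rho> by simp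
  ultimately have "\<exists>z\<in>cball x \<rho>. \<forall>y\<in>cball x \<rho>.
      w z + ?k * (norm (z - x))\<^sup>2 \<le> w y + ?k * (norm (y - x))\<^sup>2"
    by (intro continuous_attains_inf compact_cball)
  then obtain z where z: "z \<in> cball x \<rho>"
    and min: "\<And>y. y \<in> cball x \<rho> \<Longrightarrow> w z + ?k * (norm (z - x))\<^sup>2 \<le> w y + ?k * (norm (y - x))\<^sup>2"
    by blast
  have zx: "w z + ?k * (norm (z - x))\<^sup>2 \<le> w x" using min[of x] \<rho> by simp
  have all: "w z + ?k * (norm (z - x))\<^sup>2 \<le> w y + ?k * (norm (y - x))\<^sup>2" for y
  proof (cases "y \<in> cball x \<rho>")
    case False
    then have "\<rho> \<le> norm (y - x)" by (simp add: dist_norm norm_minus_commute)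
    then have "\<rho>\<^sup>2 \<le> (norm (y - x))\<^sup>2" using \<rho> by (intro power_mono) auto
    then have "?k * \<rho>\<^sup>2 \<le> ?k * (norm (y - x))\<^sup>2" using k by (rule mult_left_mono)
    then have "\<epsilon> \<le> ?k * (norm (y - x))\<^sup>2" using \<rho> by simp
    then show ?thesis using zx low[of y] by linarith
  qed (rule min)
  show ?thesis
  proof (rule that[of z "(2 * ?k) *\<^sub>R (z - x)"])
    show "dist x z \<le> \<rho>" using z by simp
    have "0 \<le> ?k * (norm (z - x))\<^sup>2" using k by (intro mult_nonneg_nonneg) auto
    then show "w z \<le> w x" using zx by linarith
    fix y
    have "(norm (y - x))\<^sup>2 = (norm (z - y))\<^sup>2 + 2 * ((z - x) \<bullet> (y - z)) + (norm (z - x))\<^sup>2"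
      by (simp add: power2_norm_eq_inner inner_diff_left inner_diff_right inner_commute algebra_simps)
    then have "?k * (norm (y - x))\<^sup>2 = ?k * (norm (z - y))\<^sup>2 + ((2 * ?k) *\<^sub>R (z - x)) \<bullet> (y - z) + ?k * (norm (z - x))\<^sup>2"
      by (simp only: distrib_left inner_scaleR_left mult_ac)
    then show "w z - w y \<le> ?k * (norm (z - y))\<^sup>2 + ((2 * ?k) *\<^sub>R (z - x)) \<bullet> (y - z)"
      using all[of y] by linarith
  qed
qed

section \<open>Bounds for principal values\<close>

context singular_kernel
begin

text \<open>On the bounded annulus around \<open>x\<close> the weight in the definition of the function space is bounded below
  and the kernel is bounded; beyond distance \<open>1\<close> integrability is the hypothesis on the tail.\<close>

lemma truncated_integrable:
  assumes u: "u \<in> L_space s"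
    and tail: "set_integrable lebesgue {y. 1 \<le> norm (y - x)} (\<lambda>y. \<bar>u y\<bar> * \<kappa> x y)"
    and \<eta>: "0 < \<eta>"
  shows "set_integrable lebesgue (- ball x \<eta>) (\<lambda>y. (u x - u y) * \<kappa> x y)"
proof -
  let ?q = "real CARD('n) + 2 * s" and ?a = "(real CARD('n) + 1) / 2 + s"
  define wt where "wt = (\<lambda>y::real ^ 'n. exp (- norm y) * \<bar>u y\<bar> / (1 + norm y powr ?a))"
  have [measurable]: "u \<in> borel_measurable lebesgue" and wt: "integrable lebesgue wt"
    using u by (auto simp: L_space_def wt_def)
  have B: "ball x 1 - ball x \<eta> \<in> sets lebesgue" by auto
  have uk: "(\<lambda>y. u y * \<kappa> x y) \<in> borel_measurable lebesgue" by measurable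
  have far: "set_integrable lebesgue (- ball x 1) (\<lambda>y. u y * \<kappa> x y)"
  proof (rule set_integrable_dominated[OF _ uk])
    have "{y. 1 \<le> norm (y - x)} = - ball x 1" by (auto simp: dist_norm norm_minus_commute)
    then show "set_integrable lebesgue (- ball x 1) (\<lambda>y. \<bar>u y\<bar> * \<kappa> x y)" using tail by simp
  qed (auto simp: abs_mult kernel_nonneg)
  define W where "W = exp (norm x + 1) * (1 + (norm x + 1) powr ?a)"
  define E where "E = \<Lambda> * \<eta> powr (- ?q)"
  have E: "0 < E" using \<Lambda> \<eta> by (simp add: E_def)
  have near: "set_integrable lebesgue (ball x 1 - ball x \<eta>) (\<lambda>y. u y * \<kappa> x y)"
  proof (rule set_integrable_dominated[OF _ uk B])
    have "set_integrable lebesgue (ball x 1 - ball x \<eta>) wt"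
      using integrable_mult_indicator[OF B wt] by (simp add: set_integrable_def)
    then show "set_integrable lebesgue (ball x 1 - ball x \<eta>) (\<lambda>y. (E * W) * wt y)"
      by (rule set_integrable_mult_right)
    fix y assume y: "y \<in> ball x 1 - ball x \<eta>"
    have ny: "norm y \<le> norm x + 1"
      using y norm_triangle_sub[of y x] by (simp add: dist_norm norm_minus_commute)
    have "\<kappa> x y \<le> \<Lambda> * norm (x - y) powr (- ?q)" by (rule kernel_le)
    also have "\<dots> \<le> E"
      unfolding E_def using y \<eta> \<Lambda> s by (intro mult_left_mono powr_mono2') (auto simp: dist_norm)
    finally have kE: "\<kappa> x y \<le> E" .
    have pos: "0 < 1 + norm y powr ?a" by (simp add: add_pos_nonneg)
    have "1 + norm y powr ?a \<le> 1 + (norm x + 1) powr ?a"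
      using ny s by (intro add_left_mono powr_mono2) auto
    then have "exp (norm y) * (1 + norm y powr ?a) \<le> W"
      unfolding W_def using ny pos by (intro mult_mono) auto
    then have "exp (norm y) * (1 + norm y powr ?a) * wt y \<le> W * wt y"
      using pos by (intro mult_right_mono) (auto simp: wt_def)
    moreover have "exp (norm y) * (1 + norm y powr ?a) * wt y = \<bar>u y\<bar>"
      using pos by (simp add: wt_def exp_minus)
    ultimately have uW: "\<bar>u y\<bar> \<le> W * wt y" by simp
    have "\<bar>u y * \<kappa> x y\<bar> = \<kappa> x y * \<bar>u y\<bar>" by (simp add: abs_mult kernel_nonneg mult_ac)
    also have "\<dots> \<le> E * (W * wt y)"
      using kE uW E by (intro mult_mono) auto
    finally show "\<bar>u y * \<kappa> x y\<bar> \<le> (E * W) * wt y" by (simp add: mult_ac)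
  qed
  have "set_integrable lebesgue ((ball x 1 - ball x \<eta>) \<union> - ball x 1) (\<lambda>y. u y * \<kappa> x y)"
    by (rule set_integrable_Un[OF near far]) auto
  then have "set_integrable lebesgue (- ball x \<eta>) (\<lambda>y. u y * \<kappa> x y)"
    by (rule set_integrable_subset) auto
  moreover have "set_integrable lebesgue (- ball x \<eta>) (\<kappa> x)" using kernel_tail \<eta> by metis
  then have "set_integrable lebesgue (- ball x \<eta>) (\<lambda>y. u x * \<kappa> x y)"
    by (rule set_integrable_mult_right)
  ultimately show ?thesis
    unfolding left_diff_distrib by (rule set_integral_diff(1)[rotated])
qed

text \<open>The region \<open>S\<close> is where \<open>u\<close> is known to be nonnegative. When \<open>u z\<close> is negative, \<open>S\<close> produces the
  negative main term. The remaining mass costs only \<open>\<epsilon>\<close> times a quantity of the scaling order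
  \<open>\<rho> powr (-2s)\<close>: inside the ball through the second moment of the kernel, outside through its tail.\<close>

lemma principal_value_le_at_touching_point:
  obtains C where "0 \<le> C"
    "\<And>u z a \<rho> \<epsilon> S l. 0 < \<rho> \<Longrightarrow> 0 \<le> \<epsilon> \<Longrightarrow> S \<in> sets lebesgue \<Longrightarrow> S \<subseteq> - ball z \<rho> \<Longrightarrow>
       (\<And>\<eta>. 0 < \<eta> \<Longrightarrow> set_integrable lebesgue (- ball z \<eta>) (\<lambda>y. (u z - u y) * \<kappa> z y)) \<Longrightarrow>
       (\<And>y. u z - u y \<le> \<epsilon> / \<rho>\<^sup>2 * (norm (z - y))\<^sup>2 + a \<bullet> (y - z)) \<Longrightarrow>
       (\<And>y. u z - u y \<le> \<epsilon>) \<Longrightarrow> (\<And>y. y \<in> S \<Longrightarrow> 0 \<le> u y) \<Longrightarrow>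
       (trunc u z \<longlongrightarrow> l) (at_right 0) \<Longrightarrow>
       l \<le> \<epsilon> * C * \<rho> powr (- (2 * s)) + u z * (LINT y:S|lebesgue. \<kappa> z y)"
proof -
  obtain C1 where C1: "0 \<le> C1"
    and i1: "\<And>x \<rho>. 0 < \<rho> \<Longrightarrow> set_integrable lebesgue (- ball x \<rho>) (\<kappa> x)"
    and le1: "\<And>x \<rho>. 0 < \<rho> \<Longrightarrow> (LINT y:- ball x \<rho>|lebesgue. \<kappa> x y) \<le> C1 * \<Lambda> * \<rho> powr (- (2 * s))"
    by (rule kernel_tail) blast
  obtain C2 where C2: "0 \<le> C2"
    and i2: "\<And>x \<rho>. 0 < \<rho> \<Longrightarrow> set_integrable lebesgue (ball x \<rho>) (\<lambda>y. (norm (x - y))\<^sup>2 * \<kappa> x y)"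
    and le2: "\<And>x \<rho>. 0 < \<rho> \<Longrightarrow> (LINT y:ball x \<rho>|lebesgue. (norm (x - y))\<^sup>2 * \<kappa> x y) \<le> C2 * \<Lambda> * \<rho> powr (2 - 2 * s)"
    by (rule kernel_second_moment) blast
  show ?thesis
  proof (rule that[of "(C1 + C2) * \<Lambda>"])
    show "0 \<le> (C1 + C2) * \<Lambda>" using C1 C2 \<Lambda> by simp
    fix u z a \<rho> \<epsilon> S l
    assume \<rho>: "0 < \<rho>" and \<epsilon>: "0 \<le> \<epsilon>" and S: "S \<in> sets lebesgue" "S \<subseteq> - ball z \<rho>"
      and int: "\<And>\<eta>. 0 < \<eta> \<Longrightarrow> set_integrable lebesgue (- ball z \<eta>) (\<lambda>y. (u z - u y) * \<kappa> z y)"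
      and near: "\<And>y. u z - u y \<le> \<epsilon> / \<rho>\<^sup>2 * (norm (z - y))\<^sup>2 + a \<bullet> (y - z)"
      and far: "\<And>y. u z - u y \<le> \<epsilon>" and uS: "\<And>y. y \<in> S \<Longrightarrow> 0 \<le> u y"
      and lim: "(trunc u z \<longlongrightarrow> l) (at_right 0)"
    let ?k = "\<epsilon> / \<rho>\<^sup>2"
    let ?IS = "LINT y:S|lebesgue. \<kappa> z y"
    have k: "0 \<le> ?k" using \<epsilon> by simp
    have nearI: "(LINT y:ball z \<rho> - ball z \<eta>|lebesgue. (u z - u y) * \<kappa> z y) \<le> \<epsilon> * (C2 * \<Lambda>) * \<rho> powr (- (2 * s))"
      if \<eta>: "0 < \<eta>" "\<eta> < \<rho>" for \<eta>
    proof -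
      let ?A = "ball z \<rho> - ball z \<eta>"
      have A: "set_integrable lebesgue ?A (\<lambda>y. (norm (z - y))\<^sup>2 * \<kappa> z y)"
        by (rule set_integrable_subset[OF i2[OF \<rho>]]) auto
      then have A': "set_integrable lebesgue ?A (\<lambda>y. ?k * ((norm (z - y))\<^sup>2 * \<kappa> z y))"
        by (rule set_integrable_mult_right)
      note B = linear_part_integral[OF \<eta>(1), of z \<rho> a]
      have "(LINT y:?A|lebesgue. (u z - u y) * \<kappa> z y)
         \<le> (LINT y:?A|lebesgue. ?k * ((norm (z - y))\<^sup>2 * \<kappa> z y) + (a \<bullet> (y - z)) * \<kappa> z y)"
      proof (rule set_integral_mono)
        show "set_integrable lebesgue ?A (\<lambda>y. (u z - u y) * \<kappa> z y)"
          using trunc_split(2)[where u = u and x = z and \<eta> = \<eta> and \<rho> = \<rho>] int \<eta> by simp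
        show "set_integrable lebesgue ?A (\<lambda>y. ?k * ((norm (z - y))\<^sup>2 * \<kappa> z y) + (a \<bullet> (y - z)) * \<kappa> z y)"
          by (rule set_integral_add(1)[OF A' B(1)])
        show "(u z - u y) * \<kappa> z y \<le> ?k * ((norm (z - y))\<^sup>2 * \<kappa> z y) + (a \<bullet> (y - z)) * \<kappa> z y" for y
          using mult_right_mono[OF near kernel_nonneg[of z y]] by (simp add: algebra_simps)
      qed
      also have "\<dots> = ?k * (LINT y:?A|lebesgue. (norm (z - y))\<^sup>2 * \<kappa> z y)"
        unfolding set_integral_add(2)[OF A' B(1)] B(2) by simp
      also have "\<dots> \<le> ?k * (LINT y:ball z \<rho>|lebesgue. (norm (z - y))\<^sup>2 * \<kappa> z y)"
      proof (rule mult_left_mono[OF _ k])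
        show "(LINT y:?A|lebesgue. (norm (z - y))\<^sup>2 * \<kappa> z y) \<le> (LINT y:ball z \<rho>|lebesgue. (norm (z - y))\<^sup>2 * \<kappa> z y)"
          unfolding set_lebesgue_integral_def
          by (rule integral_mono[OF A[unfolded set_integrable_def] i2[OF \<rho>, unfolded set_integrable_def]])
             (auto split: split_indicator simp: kernel_nonneg)
      qed
      also have "\<dots> \<le> ?k * (C2 * \<Lambda> * \<rho> powr (2 - 2 * s))"
        by (rule mult_left_mono[OF le2[OF \<rho>] k])
      also have "\<dots> = \<epsilon> * (C2 * \<Lambda>) * \<rho> powr (- (2 * s))"
        using \<rho> by (simp add: powr_diff powr_minus powr_numeral field_simps)
      finally show ?thesis .
    qed
    have farI: "trunc u z \<rho> \<le> \<epsilon> * (C1 * \<Lambda>) * \<rho> powr (- (2 * s)) + u z * ?IS"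
    proof -
      let ?B = "- ball z \<rho>"
      have kS: "set_integrable lebesgue ?B (\<lambda>y. indicator S y * \<kappa> z y)"
        by (rule set_integrable_dominated[OF i1[OF \<rho>]])
           (use S kernel_nonneg in \<open>auto split: split_indicator intro!: borel_measurable_times borel_measurable_indicator\<close>)
      have 1: "set_integrable lebesgue ?B (\<lambda>y. \<epsilon> * \<kappa> z y)"
        by (rule set_integrable_mult_right) (rule i1[OF \<rho>])
      have 2: "set_integrable lebesgue ?B (\<lambda>y. u z * (indicator S y * \<kappa> z y))"
        by (rule set_integrable_mult_right) (rule kS)
      have "trunc u z \<rho> \<le> (LINT y:?B|lebesgue. \<epsilon> * \<kappa> z y + u z * (indicator S y * \<kappa> z y))"
        unfolding trunc_def outside_ball
      proof (rule set_integral_mono[OF int[OF \<rho>] set_integral_add(1)[OF 1 2]])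
        fix y
        have "u z - u y \<le> \<epsilon> + u z * indicator S y"
          using far[of y] uS[of y] \<epsilon> by (auto split: split_indicator)
        from mult_right_mono[OF this kernel_nonneg[of z y]]
        show "(u z - u y) * \<kappa> z y \<le> \<epsilon> * \<kappa> z y + u z * (indicator S y * \<kappa> z y)"
          by (simp add: algebra_simps)
      qed
      also have "\<dots> = \<epsilon> * (LINT y:?B|lebesgue. \<kappa> z y) + u z * (LINT y:?B|lebesgue. indicator S y * \<kappa> z y)"
        unfolding set_integral_add(2)[OF 1 2] by simp
      also have "(LINT y:?B|lebesgue. indicator S y * \<kappa> z y) = ?IS"
        unfolding set_lebesgue_integral_def using S(2)
        by (intro Bochner_Integration.integral_cong refl) (auto split: split_indicator)
      also have "\<epsilon> * (LINT y:?B|lebesgue. \<kappa> z y) \<le> \<epsilon> * (C1 * \<Lambda> * \<rho> powr (- (2 * s)))"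
        by (rule mult_left_mono[OF le1[OF \<rho>] \<epsilon>])
      finally show ?thesis by (simp add: mult_ac)
    qed
    have "trunc u z \<eta> \<le> \<epsilon> * ((C1 + C2) * \<Lambda>) * \<rho> powr (- (2 * s)) + u z * ?IS" if \<eta>: "0 < \<eta>" "\<eta> < \<rho>" for \<eta>
      using trunc_split(1)[OF \<eta>(1) less_imp_le[OF \<eta>(2)] int[OF \<eta>(1)]] nearI[OF \<eta>] farI
      by (simp add: algebra_simps)
    then have "\<forall>\<^sub>F \<eta> in at_right 0. trunc u z \<eta> \<le> \<epsilon> * ((C1 + C2) * \<Lambda>) * \<rho> powr (- (2 * s)) + u z * ?IS"
      by (intro eventually_at_rightI[OF _ \<rho>]) simp
    then show "l \<le> \<epsilon> * ((C1 + C2) * \<Lambda>) * \<rho> powr (- (2 * s)) + u z * ?IS"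
      by (rule tendsto_upperbound[OF lim]) simp
  qed
qed

text \<open>At a zero of a nonnegative function the truncated integrals are nonpositive and become smaller as the
  truncation radius shrinks. If their limit is nonnegative, each of them is \<open>0\<close>.\<close>

lemma AE_zero_of_principal_value_nonneg:
  assumes u: "\<And>y. 0 \<le> u y" "u x = 0"
    and pos: "\<And>y. y \<noteq> x \<Longrightarrow> 0 < \<kappa> x y"
    and int: "\<And>\<eta>. 0 < \<eta> \<Longrightarrow> set_integrable lebesgue (- ball x \<eta>) (\<lambda>y. (u x - u y) * \<kappa> x y)"
    and lim: "(trunc u x \<longlongrightarrow> l) (at_right 0)" and l: "0 \<le> l"
  shows "AE y in lebesgue. u y = 0"
proof -
  have zero: "AE y in lebesgue. y \<notin> ball x \<eta> \<longrightarrow> u y = 0" if \<eta>: "0 < \<eta>" for \<eta>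
  proof -
    have "trunc u x \<theta> \<le> trunc u x \<eta>" if "0 < \<theta>" "\<theta> < \<eta>" for \<theta>
    proof -
      note sp = trunc_split[OF that(1) less_imp_le[OF that(2)] int[OF that(1)]]
      have "(LINT y:ball x \<eta> - ball x \<theta>|lebesgue. (u x - u y) * \<kappa> x y)
         \<le> (LINT y:ball x \<eta> - ball x \<theta>|lebesgue. 0)"
        by (rule set_integral_mono[OF sp(2)]) (simp_all add: set_integrable_def u kernel_nonneg)
      then show ?thesis using sp(1) by (simp add: set_lebesgue_integral_def)
    qed
    then have "\<forall>\<^sub>F \<theta> in at_right 0. trunc u x \<theta> \<le> trunc u x \<eta>"
      by (intro eventually_at_rightI[OF _ \<eta>]) simp
    then have "l \<le> trunc u x \<eta>" by (rule tendsto_upperbound[OF lim]) simp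
    then have ge: "0 \<le> trunc u x \<eta>" using l by simp
    let ?f = "\<lambda>y. indicator (- ball x \<eta>) y *\<^sub>R (u y * \<kappa> x y)"
    have f: "?f = (\<lambda>y. - (indicator (- ball x \<eta>) y *\<^sub>R ((u x - u y) * \<kappa> x y)))"
      using u(2) by (auto split: split_indicator)
    have fi: "integrable lebesgue ?f"
      using int[OF \<eta>] unfolding f set_integrable_def by (rule Bochner_Integration.integrable_minus)
    have fn: "0 \<le> ?f y" for y using u(1) kernel_nonneg by (auto split: split_indicator)
    have "integral\<^sup>L lebesgue ?f = - trunc u x \<eta>"
      unfolding f trunc_def outside_ball set_lebesgue_integral_def by (rule Bochner_Integration.integral_minus)
    then have "integral\<^sup>L lebesgue ?f \<le> 0" using ge by simp
    moreover have "0 \<le> integral\<^sup>L lebesgue ?f" using fn by (rule Bochner_Integration.integral_nonneg)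
    ultimately have "integral\<^sup>L lebesgue ?f = 0" by simp
    then have "AE y in lebesgue. ?f y = 0"
      using integral_nonneg_eq_0_iff_AE[OF fi] fn by blast
    then show ?thesis
    proof (rule AE_mp, intro AE_I2 impI)
      fix y assume "?f y = 0" "y \<notin> ball x \<eta>"
      moreover from this have "y \<noteq> x" using \<eta> by auto
      ultimately show "u y = 0" using pos[of y] by simp
    qed
  qed
  have "AE y in lebesgue. \<forall>n. y \<notin> ball x (inverse (real (Suc n))) \<longrightarrow> u y = 0"
    unfolding AE_all_countable by (intro allI zero) simp
  then show ?thesis
  proof (rule AE_mp, intro AE_I2 impI)
    fix y assume *: "\<forall>n. y \<notin> ball x (inverse (real (Suc n))) \<longrightarrow> u y = 0"
    show "u y = 0"
    proof (cases "y = x")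
      case False
      then obtain n where "inverse (real (Suc n)) < dist x y"
        using reals_Archimedean[of "dist x y"] by auto
      then show ?thesis using *[rule_format, of n] by simp
    qed (use u(2) in simp)
  qed
qed

end

section \<open>The operator in a domain with exterior density\<close>

lemma measure_annulus:
  fixes x :: "real ^ 'n"
  assumes "0 \<le> r" "r \<le> R"
  shows "measure lebesgue (annulus x r R) = unit_ball_vol (real CARD('n)) * (R ^ CARD('n) - r ^ CARD('n))"
proof -
  have b: "measure lebesgue (ball x t) = unit_ball_vol (real CARD('n)) * t ^ CARD('n)" if "0 \<le> t" for t
    using content_ball[OF that, of x] by simp
  have "measure lebesgue (ball x R - ball x r) = measure lebesgue (ball x R) - measure lebesgue (ball x r)"
    by (rule measure_Diff) (use assms in \<open>auto simp: emeasure_ball\<close>)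
  moreover have "0 \<le> R" using assms by simp
  ultimately show ?thesis by (simp only: annulus_def b assms(1) right_diff_distrib)
qed

text \<open>A domain of finite width is not the whole space, so \<open>infdist\<close> is the true distance to the complement.\<close>

lemma finite_width_infdist:
  fixes D :: "(real ^ 'n) set"
  assumes w: "width D \<le> ennreal B" and B: "0 \<le> B" and D: "open D" and x: "x \<in> D"
  shows "- D \<noteq> {}" "0 < infdist x (- D)" "infdist x (- D) \<le> enn2real (width D)" "enn2real (width D) \<le> B"
proof -
  have le: "(INF y\<in>-D. ennreal (dist x y)) \<le> width D"
    unfolding width_def using x by (rule SUP_upper)
  have fin: "width D < top" using w by (rule le_less_trans) simp
  show ne: "- D \<noteq> {}"
  proof
    assume "- D = {}"
    have "(INF y\<in>-D. ennreal (dist x y)) = top" unfolding \<open>- D = {}\<close> by simp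
    then show False using le_less_trans[OF le fin] by (simp only: less_irrefl)
  qed
  show "0 < infdist x (- D)"
    using infdist_pos_not_in_closed[of "- D" x] D ne x by auto
  have "ennreal (infdist x (- D)) \<le> (INF y\<in>-D. ennreal (dist x y))"
    by (intro INF_greatest ennreal_leI infdist_le)
  then have "ennreal (infdist x (- D)) \<le> width D" using le by (rule order_trans)
  then have "enn2real (ennreal (infdist x (- D))) \<le> enn2real (width D)"
    using fin by (intro enn2real_mono)
  then show "infdist x (- D) \<le> enn2real (width D)" by (simp add: infdist_nonneg)
  have "enn2real (width D) \<le> enn2real (ennreal B)" using w by (intro enn2real_mono) auto
  then show "enn2real (width D) \<le> B" using B by simp
qed

lemma op_const_pos: "0 < s \<Longrightarrow> s < 1 \<Longrightarrow> 0 < op_const TYPE('n::finite) s"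
  unfolding op_const_def by (intro mult_pos_pos divide_pos_pos Gamma_real_pos) auto

text \<open>The constant \<open>A\<close> in front of \<open>r powr (-2s)\<close> in the main term, with \<open>c0\<close> the lower comparison constant
  of the Bessel function.\<close>

definition density_const :: "'n::finite itself \<Rightarrow> real \<Rightarrow> real \<Rightarrow> real \<Rightarrow> real \<Rightarrow> real" where
  "density_const _ s c0 c1 c2 = op_const TYPE('n) s * c0 * unit_ball_vol (real CARD('n)) *
     c2 powr (- (real CARD('n) + 2 * s)) * (c2 ^ CARD('n) - 1) * c1"

text \<open>The properties of the Bessel function established above, with fixed comparison constants, together with
  the mass \<open>m\<close>. The first parameter only carries the dimension.\<close>

locale bessel_kernel_bounds =
  fixes index :: "'n::finite itself" and s r0 c0 C1 m :: real
  assumes s_pos: "0 < s" and s_less: "s < 1" and m: "0 < m" and c0: "0 < c0" and C1: "0 < C1"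
    and K_ge: "\<And>r. 0 < r \<Longrightarrow> r \<le> r0 \<Longrightarrow>
      c0 * r powr (- (real CARD('n) / 2 + s)) \<le> bessel_K (real CARD('n) / 2 + s) r"
    and K_le: "\<And>r. 0 < r \<Longrightarrow>
      bessel_K (real CARD('n) / 2 + s) r \<le> C1 * r powr (- (real CARD('n) / 2 + s))"
    and K_pos: "\<And>r. 0 < r \<Longrightarrow> 0 < bessel_K (real CARD('n) / 2 + s) r"
    and K_antimono: "\<And>r r'. 0 < r \<Longrightarrow> r \<le> r' \<Longrightarrow>
      bessel_K (real CARD('n) / 2 + s) r' \<le> bessel_K (real CARD('n) / 2 + s) r"
begin

abbreviation "\<kappa> \<equiv> bessel_kernel m s :: real ^ 'n \<Rightarrow> real ^ 'n \<Rightarrow> real"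

text \<open>The exponents combine because \<open>2\<nu> = N + 2s\<close>.\<close>

lemma powr_rescale: "0 < t \<Longrightarrow> (m * t) powr (- (real CARD('n) / 2 + s)) / t powr (real CARD('n) / 2 + s) = m powr (- (real CARD('n) / 2 + s)) * t powr (- (real CARD('n) + 2 * s))"
proof -
  assume t: "0 < t"
  have "t powr (- (real CARD('n) + 2 * s)) = t powr (- (real CARD('n) / 2 + s)) * t powr (- (real CARD('n) / 2 + s))"
  proof -
    have "- (real CARD('n) + 2 * s) = - (real CARD('n) / 2 + s) + - (real CARD('n) / 2 + s)" by simp
    then show ?thesis by (simp only: powr_add)
  qed
  then show ?thesis using t m by (simp add: powr_mult powr_minus field_simps)
qed

lemma bessel_kernel_pos: "x \<noteq> y \<Longrightarrow> 0 < \<kappa> x y"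
  using m by (simp add: bessel_kernel_def K_pos)

lemma bessel_kernel_ge:
  assumes "x \<noteq> y" "m * norm (x - y) \<le> r0"
  shows "c0 * m powr (- (real CARD('n) / 2 + s)) * norm (x - y) powr (- (real CARD('n) + 2 * s)) \<le> \<kappa> x y"
proof -
  have t: "0 < norm (x - y)" using assms by simp
  have "c0 * (m * norm (x - y)) powr (- (real CARD('n) / 2 + s)) / norm (x - y) powr (real CARD('n) / 2 + s) \<le> \<kappa> x y"
    unfolding bessel_kernel_def using t m assms by (intro divide_right_mono K_ge) auto
  then show ?thesis using powr_rescale[OF t] by (simp add: mult.assoc times_divide_eq_right[symmetric] del: times_divide_eq_right)
qed

sublocale singular_kernel \<kappa> s "C1 * m powr (- (real CARD('n) / 2 + s))"
proof
  show "0 < s" "s < 1" by (rule s_pos, rule s_less)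
  show "\<kappa> x \<in> borel_measurable lebesgue" for x
    by (rule bessel_kernel_measurable[OF K_antimono m])
  show nonneg: "0 \<le> \<kappa> x y" for x y
    using bessel_kernel_pos[of x y] by (cases "x = y") (auto simp: bessel_kernel_def)
  show "\<kappa> x y \<le> C1 * m powr (- (real CARD('n) / 2 + s)) * norm (x - y) powr (- (real CARD('n) + 2 * s))" for x y
  proof (cases "x = y")
    case False
    then have t: "0 < norm (x - y)" by simp
    have "\<kappa> x y \<le> C1 * (m * norm (x - y)) powr (- (real CARD('n) / 2 + s)) / norm (x - y) powr (real CARD('n) / 2 + s)"
      unfolding bessel_kernel_def using t m by (intro divide_right_mono K_le) auto
    then show ?thesis using powr_rescale[OF t] by (simp add: mult.assoc times_divide_eq_right[symmetric] del: times_divide_eq_right)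
  qed (simp add: bessel_kernel_def)
  show "\<kappa> x (2 *\<^sub>R x - y) = \<kappa> x y" for x y by (rule bessel_kernel_point_reflection)
  show "0 < C1 * m powr (- (real CARD('n) / 2 + s))" using C1 m by simp
qed

text \<open>Convergence of the principal value identifies the limit in the definition of the operator.\<close>

lemma bessel_op_principal_value:
  fixes w :: "real ^ 'n \<Rightarrow> real"
  assumes w: "w \<in> L_space s" "tail_integrable m s w" "w \<in> C11_loc D" and D: "open D" "x \<in> D"
  obtains l where "(trunc w x \<longlongrightarrow> l) (at_right 0)"
    "bessel_op m s w x = op_const TYPE('n) s * m powr (real CARD('n) / 2 + s) * l + m powr (2 * s) * w x"
    "\<And>\<eta>. 0 < \<eta> \<Longrightarrow> set_integrable lebesgue (- ball x \<eta>) (\<lambda>y. (w x - w y) * \<kappa> x y)"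
proof -
  have int: "set_integrable lebesgue (- ball x \<eta>) (\<lambda>y. (w x - w y) * \<kappa> x y)" if "0 < \<eta>" for \<eta>
    using w(2) that by (intro truncated_integrable w(1)) (auto simp: tail_integrable_def)
  have meas: "w \<in> borel_measurable lebesgue" using w(1) by (simp add: L_space_def)
  obtain a L \<delta> where L: "0 < L" and \<delta>: "0 < \<delta>"
    and q: "\<And>y. y \<in> ball x \<delta> \<Longrightarrow> \<bar>w x - w y + a \<bullet> (y - x)\<bar> \<le> L * (norm (x - y))\<^sup>2"
    by (rule C11_loc_quadratic[OF w(3) D]) blast
  obtain l where l: "(trunc w x \<longlongrightarrow> l) (at_right 0)"
    by (rule principal_value_converges[OF meas int \<delta> L q])
  have "Lim (at_right 0) (trunc w x) = l"
    by (rule tendsto_Lim[OF _ l]) simp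
  then have "bessel_op m s w x = op_const TYPE('n) s * m powr (real CARD('n) / 2 + s) * l + m powr (2 * s) * w x"
    unfolding bessel_op_def trunc_def[abs_def] by simp
  then show ?thesis using int by (rule that[OF l])
qed

text \<open>On the annulus the kernel is at least its lower bound at the outer radius \<open>c2 * r\<close>, and the exterior part
  of the annulus fills a fixed proportion of its volume.\<close>

lemma exterior_kernel_mass:
  fixes D :: "(real ^ 'n) set"
  assumes dens: "exterior_density D c1 c2" and c2: "1 < c2" and D: "open D" and z: "z \<in> D"
    and r: "r = infdist z (- D)" "0 < r" "m * (c2 * r) \<le> r0"
  shows "c0 * m powr (- (real CARD('n) / 2 + s)) * (c2 powr (- (real CARD('n) + 2 * s)) *
           (unit_ball_vol (real CARD('n)) * (c2 ^ CARD('n) - 1) * c1)) * r powr (- (2 * s))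
         \<le> (LINT y:annulus z r (c2 * r) \<inter> - D|lebesgue. \<kappa> z y)"
proof -
  let ?q = "real CARD('n) + 2 * s" and ?N = "CARD('n)"
  let ?S = "annulus z r (c2 * r) \<inter> - D"
  define k where "k = c0 * m powr (- (real CARD('n) / 2 + s)) * (c2 * r) powr (- ?q)"
  have k: "0 < k" unfolding k_def using c0 m c2 r by simp
  have S: "?S \<in> sets lebesgue" "?S \<subseteq> ball z (c2 * r)" "?S \<subseteq> - ball z r"
    using D by (auto simp: annulus_def)
  have fin: "?S \<in> fmeasurable lebesgue"
    using S by (intro fmeasurableI2[OF lmeasurable_ball]) auto
  have c2r: "r \<le> c2 * r" using c2 r by simp
  have "c1 \<le> measure lebesgue ?S / measure lebesgue (annulus z r (c2 * r))"
    using dens z r(1) by (simp add: exterior_density_def Let_def)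
  moreover have ann: "measure lebesgue (annulus z r (c2 * r)) = unit_ball_vol (real ?N) * ((c2 ^ ?N - 1) * r ^ ?N)"
    using r(2) c2r by (subst measure_annulus) (auto simp: power_mult_distrib algebra_simps)
  moreover have "0 < c2 ^ ?N - 1" using c2 by (simp add: one_less_power)
  ultimately have mS: "c1 * (unit_ball_vol (real ?N) * ((c2 ^ ?N - 1) * r ^ ?N)) \<le> measure lebesgue ?S"
    using r(2) by (subst (asm) le_divide_eq) auto
  have kS: "set_integrable lebesgue ?S (\<kappa> z)"
    using kernel_tail r(2) S by (metis set_integrable_subset)
  have "k * (c1 * (unit_ball_vol (real ?N) * ((c2 ^ ?N - 1) * r ^ ?N))) \<le> k * measure lebesgue ?S"
    using mS k by (intro mult_left_mono) auto
  also have "\<dots> = (LINT y:?S|lebesgue. k)"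
    using fin by (simp add: set_lebesgue_integral_def fmeasurable_def)
  also have "\<dots> \<le> (LINT y:?S|lebesgue. \<kappa> z y)"
  proof (rule set_integral_mono[OF _ kS])
    show "set_integrable lebesgue ?S (\<lambda>y. k)"
      using fin unfolding set_integrable_def by (intro integrable_scaleR_left integrable_real_indicator) (auto simp: fmeasurable_def)
    fix y assume y: "y \<in> ?S"
    have d: "r \<le> norm (z - y)" "norm (z - y) < c2 * r" using y S by (auto simp: dist_norm)
    have "m * norm (z - y) \<le> m * (c2 * r)" using d m by (intro mult_left_mono) auto
    then have "c0 * m powr (- (real CARD('n) / 2 + s)) * norm (z - y) powr (- ?q) \<le> \<kappa> z y"
      using d r by (intro bessel_kernel_ge) auto
    moreover have "(c2 * r) powr (- ?q) \<le> norm (z - y) powr (- ?q)"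
      using d r s_pos by (intro powr_mono2') auto
    then have "k \<le> c0 * m powr (- (real CARD('n) / 2 + s)) * norm (z - y) powr (- ?q)"
      unfolding k_def using c0 by (intro mult_left_mono) auto
    ultimately show "k \<le> \<kappa> z y" by linarith
  qed
  finally have main: "k * (c1 * (unit_ball_vol (real ?N) * ((c2 ^ ?N - 1) * r ^ ?N))) \<le> (LINT y:?S|lebesgue. \<kappa> z y)" .
  have "r powr (- (2 * s)) = r powr (- ?q) * r ^ ?N"
    using r(2) by (simp add: powr_realpow[symmetric] powr_add[symmetric])
  moreover have "(c2 * r) powr (- ?q) = c2 powr (- ?q) * r powr (- ?q)"
    using c2 r(2) by (simp add: powr_mult)
  ultimately show ?thesis using main by (simp add: k_def mult_ac)
qed

text \<open>The exterior part of the annulus around \<open>z\<close> plays the role of the region where \<open>w\<close> is nonnegative.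
  The comparability of \<open>\<rho>\<close> with the distance of \<open>z\<close> to the complement turns the error into the same
  power of that distance as the main term.\<close>

lemma bessel_op_le_at_touching_point:
  fixes D :: "(real ^ 'n) set"
  assumes w: "w \<in> L_space s" "tail_integrable m s w" "w \<in> C11_loc D" and D: "open D"
    and dens: "exterior_density D c1 c2" and c2: "1 < c2" and ext: "\<And>x. x \<in> - D \<Longrightarrow> 0 \<le> w x"
  obtains K where "0 \<le> K"
    "\<And>z a \<rho> \<epsilon>. z \<in> D \<Longrightarrow> w z \<le> 0 \<Longrightarrow>
       0 < infdist z (- D) \<Longrightarrow> m * (c2 * infdist z (- D)) \<le> r0 \<Longrightarrow>
       0 < \<rho> \<Longrightarrow> \<rho> \<le> infdist z (- D) \<Longrightarrow> infdist z (- D) \<le> 3 * \<rho> \<Longrightarrow> 0 \<le> \<epsilon> \<Longrightarrow>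
       (\<And>y. w z - w y \<le> \<epsilon> / \<rho>\<^sup>2 * (norm (z - y))\<^sup>2 + a \<bullet> (y - z)) \<Longrightarrow> (\<And>y. w z - w y \<le> \<epsilon>) \<Longrightarrow>
       bessel_op m s w z \<le> (\<epsilon> * K + w z * density_const TYPE('n) s c0 c1 c2) * infdist z (- D) powr (- (2 * s))
                             + m powr (2 * s) * w z"
proof -
  obtain C where C: "0 \<le> C"
    and pv: "\<And>u z a \<rho> \<epsilon> S l. 0 < \<rho> \<Longrightarrow> 0 \<le> \<epsilon> \<Longrightarrow> S \<in> sets lebesgue \<Longrightarrow> S \<subseteq> - ball z \<rho> \<Longrightarrow>
       (\<And>\<eta>. 0 < \<eta> \<Longrightarrow> set_integrable lebesgue (- ball z \<eta>) (\<lambda>y. (u z - u y) * \<kappa> z y)) \<Longrightarrow>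
       (\<And>y. u z - u y \<le> \<epsilon> / \<rho>\<^sup>2 * (norm (z - y))\<^sup>2 + a \<bullet> (y - z)) \<Longrightarrow>
       (\<And>y. u z - u y \<le> \<epsilon>) \<Longrightarrow> (\<And>y. y \<in> S \<Longrightarrow> 0 \<le> u y) \<Longrightarrow>
       (trunc u z \<longlongrightarrow> l) (at_right 0) \<Longrightarrow>
       l \<le> \<epsilon> * C * \<rho> powr (- (2 * s)) + u z * (LINT y:S|lebesgue. \<kappa> z y)"
    by (rule principal_value_le_at_touching_point) blast
  define P where "P = op_const TYPE('n) s * m powr (real CARD('n) / 2 + s)"
  have P: "0 < P" unfolding P_def using op_const_pos[where 'n = 'n, OF s_pos s_less] m by simp
  show ?thesis
  proof (rule that[of "P * C * 3 powr (2 * s)"])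
    show "0 \<le> P * C * 3 powr (2 * s)" using P C by simp
    fix z a :: "real ^ 'n" and \<rho> \<epsilon> :: real
    assume z: "z \<in> D"
      and wz: "w z \<le> 0" and r: "0 < infdist z (- D)" "m * (c2 * infdist z (- D)) \<le> r0"
      and \<rho>: "0 < \<rho>" "\<rho> \<le> infdist z (- D)" "infdist z (- D) \<le> 3 * \<rho>" and \<epsilon>: "0 \<le> \<epsilon>"
      and near: "\<And>y. w z - w y \<le> \<epsilon> / \<rho>\<^sup>2 * (norm (z - y))\<^sup>2 + a \<bullet> (y - z)"
      and far: "\<And>y. w z - w y \<le> \<epsilon>"
    let ?r = "infdist z (- D)"
    let ?S = "annulus z ?r (c2 * ?r) \<inter> - D"
    define I0 where "I0 = c0 * m powr (- (real CARD('n) / 2 + s)) * (c2 powr (- (real CARD('n) + 2 * s)) *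
           (unit_ball_vol (real CARD('n)) * (c2 ^ CARD('n) - 1) * c1)) * ?r powr (- (2 * s))"
    obtain l where l: "(trunc w z \<longlongrightarrow> l) (at_right 0)"
      and op: "bessel_op m s w z = P * l + m powr (2 * s) * w z"
      and int: "\<And>\<eta>. 0 < \<eta> \<Longrightarrow> set_integrable lebesgue (- ball z \<eta>) (\<lambda>y. (w z - w y) * \<kappa> z y)"
      unfolding P_def using bessel_op_principal_value[OF w D z] by blast
    have "l \<le> \<epsilon> * C * \<rho> powr (- (2 * s)) + w z * (LINT y:?S|lebesgue. \<kappa> z y)"
    proof (rule pv[OF \<rho>(1) \<epsilon> _ _ int near far _ l])
      show "?S \<in> sets lebesgue" using D by (auto simp: annulus_def)
      show "?S \<subseteq> - ball z \<rho>" using \<rho>(2) by (auto simp: annulus_def)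
    qed (use ext in auto)
    also have "w z * (LINT y:?S|lebesgue. \<kappa> z y) \<le> w z * I0"
      unfolding I0_def using exterior_kernel_mass[OF dens c2 D z refl r] wz by (rule mult_left_mono_neg)
    also have "\<epsilon> * C * \<rho> powr (- (2 * s)) \<le> \<epsilon> * C * (3 powr (2 * s) * ?r powr (- (2 * s)))"
    proof (rule mult_left_mono)
      have "\<rho> powr (- (2 * s)) \<le> (?r / 3) powr (- (2 * s))"
        using \<rho> r s_pos by (intro powr_mono2') auto
      also have "\<dots> = 3 powr (2 * s) * ?r powr (- (2 * s))"
        using r by (simp add: powr_divide powr_minus field_simps)
      finally show "\<rho> powr (- (2 * s)) \<le> 3 powr (2 * s) * ?r powr (- (2 * s))" .
    qed (use \<epsilon> C in simp)
    finally have Pl: "P * l \<le> P * (\<epsilon> * C * (3 powr (2 * s) * ?r powr (- (2 * s))) + w z * I0)"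
      using P by simp
    have "P * I0 = density_const TYPE('n) s c0 c1 c2 * ?r powr (- (2 * s))"
    proof -
      have "m powr (real CARD('n) / 2 + s) * m powr (- (real CARD('n) / 2 + s)) = 1" using m by (simp add: powr_add[symmetric])
      then show ?thesis by (simp add: P_def I0_def density_const_def)
    qed
    then have "P * (w z * I0) = w z * (density_const TYPE('n) s c0 c1 c2 * ?r powr (- (2 * s)))"
      by (metis mult.left_commute)
    then have "P * l \<le> P * (\<epsilon> * C * (3 powr (2 * s) * ?r powr (- (2 * s))))
        + w z * (density_const TYPE('n) s c0 c1 c2 * ?r powr (- (2 * s)))"
      using Pl by (simp only: distrib_left)
    then show "bessel_op m s w z \<le> (\<epsilon> * (P * C * 3 powr (2 * s)) + w z * density_const TYPE('n) s c0 c1 c2) * ?r powr (- (2 * s))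
                             + m powr (2 * s) * w z"
      unfolding op by (simp add: algebra_simps)
  qed
qed

end

section \<open>The maximum principle\<close>

text \<open>Multiplying the differential inequality at the touching point by \<open>r powr (2s)\<close> gives
  \<open>0 \<le> \<epsilon> K + w(z) g\<close> with \<open>w(z)\<close> close to the negative infimum and \<open>g > 0\<close> independent of \<open>\<epsilon>\<close>,
  which fails for small \<open>\<epsilon>\<close>.\<close>

lemma (in bessel_kernel_bounds) nonneg_of_coefficient_gap:
  fixes w c :: "real ^ 'n \<Rightarrow> real"
  assumes w: "w \<in> L_space s" "tail_integrable m s w" "w \<in> C11_loc D" and D: "open D"
    and dens: "exterior_density D c1 c2" and c2: "1 < c2" and r0: "0 < r0"
    and wid: "width D \<le> ennreal (r0 / (c2 * m))"
    and bdd: "bdd_below (range w)" and ext: "\<And>x. x \<in> - D \<Longrightarrow> 0 \<le> w x"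
    and super: "\<And>x. x \<in> D \<Longrightarrow> w x < 0 \<Longrightarrow> 0 \<le> bessel_op m s w x + c x * w x"
    and g: "0 < g"
    and gap: "\<And>x. x \<in> D \<Longrightarrow> w x < 0 \<Longrightarrow>
      g \<le> density_const TYPE('n) s c0 c1 c2 + infdist x (- D) powr (2 * s) * (m powr (2 * s) + c x)"
  shows "0 \<le> w x"
proof (rule ccontr)
  assume "\<not> 0 \<le> w x"
  define \<mu> where "\<mu> = Inf (range w)"
  have \<mu>_le: "\<mu> \<le> w y" for y unfolding \<mu>_def using bdd by (intro cInf_lower) auto
  then have \<mu>: "\<mu> < 0" using \<mu>_le[of x] \<open>\<not> 0 \<le> w x\<close> by linarith
  obtain K where K: "0 \<le> K"
    and op_le: "\<And>z a \<rho> \<epsilon>. z \<in> D \<Longrightarrow> w z \<le> 0 \<Longrightarrow>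
       0 < infdist z (- D) \<Longrightarrow> m * (c2 * infdist z (- D)) \<le> r0 \<Longrightarrow>
       0 < \<rho> \<Longrightarrow> \<rho> \<le> infdist z (- D) \<Longrightarrow> infdist z (- D) \<le> 3 * \<rho> \<Longrightarrow> 0 \<le> \<epsilon> \<Longrightarrow>
       (\<And>y. w z - w y \<le> \<epsilon> / \<rho>\<^sup>2 * (norm (z - y))\<^sup>2 + a \<bullet> (y - z)) \<Longrightarrow> (\<And>y. w z - w y \<le> \<epsilon>) \<Longrightarrow>
       bessel_op m s w z \<le> (\<epsilon> * K + w z * density_const TYPE('n) s c0 c1 c2) * infdist z (- D) powr (- (2 * s))
                             + m powr (2 * s) * w z"
    using bessel_op_le_at_touching_point[OF w D dens c2 ext] by metis
  \<comment> \<open>The first bound makes \<open>w\<close> at the touching point at most \<open>\<mu> / 2\<close>, the second makes the error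
    \<open>\<epsilon> * K\<close> smaller than half the main term \<open>- \<mu> * g\<close>.\<close>
  define \<epsilon> where "\<epsilon> = min (- \<mu> / 2) (- \<mu> * g / (4 * (K + 1)))"
  have \<epsilon>: "0 < \<epsilon>" using \<mu> g K by (simp add: \<epsilon>_def mult_neg_pos divide_neg_pos)
  have "\<epsilon> \<le> - \<mu> * g / (4 * (K + 1))" unfolding \<epsilon>_def by (rule min.cobounded2)
  then have "\<epsilon> * (4 * (K + 1)) \<le> - \<mu> * g"
    using K by (subst (asm) pos_le_divide_eq) auto
  then have \<epsilon>K: "\<epsilon> * K < - \<mu> * g / 2" using \<epsilon> K \<mu> g mult_neg_pos[OF \<mu> g] by (simp add: algebra_simps)
  have "Inf (range w) < \<mu> + \<epsilon>" using \<epsilon> by (simp add: \<mu>_def)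
  then obtain x where x: "w x < \<mu> + \<epsilon>" using bdd by (subst (asm) cInf_less_iff) auto
  have "\<epsilon> \<le> - \<mu> / 2" unfolding \<epsilon>_def by (rule min.cobounded1)
  then have wx: "w x < \<mu> / 2" using x by linarith
  have xD: "x \<in> D" using ext[of x] wx \<mu> by force
  have B: "0 \<le> r0 / (c2 * m)" using r0 c2 m by simp
  note wd = finite_width_infdist[OF wid B D]
  \<comment> \<open>Half the distance keeps the closed ball inside \<open>D\<close>, with distances to the complement between
    \<open>\<rho>\<close> and \<open>3 * \<rho>\<close>.\<close>
  define \<rho> where "\<rho> = infdist x (- D) / 2"
  have \<rho>: "0 < \<rho>" using wd(2)[OF xD] by (simp add: \<rho>_def)
  have inD: "y \<in> D" if "dist x y \<le> \<rho>" for y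
  proof (rule ccontr)
    assume "y \<notin> D"
    then have "infdist x (- D) \<le> dist x y" by (intro infdist_le) simp
    then show False using that \<rho> by (simp add: \<rho>_def)
  qed
  have "continuous_on (cball x \<rho>) w"
    by (rule continuous_on_subset[OF C11_loc_continuous_on[OF w(3)]]) (use inD in auto)
  moreover have "w x - \<epsilon> \<le> w y" for y using x \<mu>_le[of y] by linarith
  ultimately obtain z a where z: "dist x z \<le> \<rho>" "w z \<le> w x"
    and near: "\<And>y. w z - w y \<le> \<epsilon> / \<rho>\<^sup>2 * (norm (z - y))\<^sup>2 + a \<bullet> (y - z)"
    using touching_paraboloid[of x \<rho> w \<epsilon>] \<rho> \<epsilon> by (metis less_imp_le)
  have zD: "z \<in> D" using inD z by blast
  have wz: "w z < \<mu> / 2" "w z < 0" using z wx \<mu> by linarith+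
  have far: "w z - w y \<le> \<epsilon>" for y using z(2) x \<mu>_le[of y] by linarith
  define r where "r = infdist z (- D)"
  have r: "0 < r" "r \<le> r0 / (c2 * m)"
    using wd(2)[OF zD] wd(3)[OF zD] wd(4)[OF zD] by (auto simp: r_def)
  have mr: "m * (c2 * r) \<le> r0" using r(2) m c2 by (simp add: pos_le_divide_eq mult_ac)
  have "infdist x (- D) \<le> r + dist x z" unfolding r_def by (rule infdist_triangle)
  then have \<rho>r: "\<rho> \<le> r" using z(1) by (simp add: \<rho>_def)
  have "r \<le> infdist x (- D) + dist z x" unfolding r_def by (rule infdist_triangle)
  then have r\<rho>: "r \<le> 3 * \<rho>" using z(1) by (simp add: \<rho>_def dist_commute)
  let ?A = "density_const TYPE('n) s c0 c1 c2"
  have "bessel_op m s w z \<le> (\<epsilon> * K + w z * ?A) * r powr (- (2 * s)) + m powr (2 * s) * w z"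
    unfolding r_def
    by (rule op_le[OF zD less_imp_le[OF wz(2)] _ _ \<rho> _ _ less_imp_le[OF \<epsilon>] near far])
       (use r mr \<rho>r r\<rho> in \<open>simp_all add: r_def\<close>)
  then have "0 \<le> (\<epsilon> * K + w z * ?A) * r powr (- (2 * s)) + w z * (m powr (2 * s) + c z)"
    using super[OF zD wz(2)] by (simp add: algebra_simps)
  then have "0 \<le> ((\<epsilon> * K + w z * ?A) * r powr (- (2 * s)) + w z * (m powr (2 * s) + c z)) * r powr (2 * s)"
    by (rule mult_nonneg_nonneg) simp
  also have "\<dots> = (\<epsilon> * K + w z * ?A) * (r powr (- (2 * s)) * r powr (2 * s)) + w z * (r powr (2 * s) * (m powr (2 * s) + c z))"
    by (simp only: distrib_right distrib_left mult_ac)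
  also have "r powr (- (2 * s)) * r powr (2 * s) = 1"
    using r(1) by (simp add: powr_add[symmetric])
  also have "(\<epsilon> * K + w z * ?A) * 1 + w z * (r powr (2 * s) * (m powr (2 * s) + c z))
     = \<epsilon> * K + w z * (?A + r powr (2 * s) * (m powr (2 * s) + c z))"
    by (simp add: algebra_simps)
  finally have "0 \<le> \<epsilon> * K + w z * (?A + r powr (2 * s) * (m powr (2 * s) + c z))" .
  moreover have "w z * (?A + r powr (2 * s) * (m powr (2 * s) + c z)) \<le> w z * g"
    using gap[OF zD wz(2)] wz(2) unfolding r_def by (intro mult_left_mono_neg) auto
  moreover have "w z * g \<le> \<mu> / 2 * g" using wz g by (intro mult_right_mono) auto
  ultimately show False using \<epsilon>K by simp
qed

text \<open>The first alternative implies the weak form of the second, by \<open>d \<le> r0 / (c2 m)\<close>. Passing from the width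
  \<open>d\<close> to the distance \<open>r \<le> d\<close> of a single point is harmless: if \<open>m powr (2s) + \<gamma>\<close> is negative, the
  smaller radius gives the larger value.\<close>

lemma coefficient_condition:
  fixes s r0 c2 m d \<gamma> E :: real
  assumes s: "0 < s" and r0: "0 < r0" and c2: "1 < c2" and m: "0 < m" and E: "0 \<le> E"
    and d: "0 \<le> d" "d \<le> r0 / (c2 * m)"
    and cond: "- (1 + c2 powr (2 * s) / r0 powr (2 * s) * E) * m powr (2 * s) < \<gamma>
       \<or> - (d powr (2 * s)) * (\<gamma> + m powr (2 * s)) < E"
    and r: "0 \<le> r" "r \<le> d"
  shows "- E \<le> r powr (2 * s) * (m powr (2 * s) + \<gamma>)"
proof -
  have dE: "- E \<le> d powr (2 * s) * (m powr (2 * s) + \<gamma>)"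
    using cond
  proof
    assume h: "- (1 + c2 powr (2 * s) / r0 powr (2 * s) * E) * m powr (2 * s) < \<gamma>"
    let ?Y = "c2 powr (2 * s) / r0 powr (2 * s) * m powr (2 * s)"
    have "d powr (2 * s) \<le> (r0 / (c2 * m)) powr (2 * s)" using d s by (intro powr_mono2) auto
    then have "d powr (2 * s) * ?Y \<le> (r0 / (c2 * m)) powr (2 * s) * ?Y"
      by (intro mult_right_mono) auto
    also have "\<dots> = 1" using r0 c2 m by (simp add: powr_divide powr_mult)
    finally have "(d powr (2 * s) * ?Y) * E \<le> 1 * E" using E by (rule mult_right_mono)
    moreover have "d powr (2 * s) * (- (?Y * E)) \<le> d powr (2 * s) * (m powr (2 * s) + \<gamma>)"
    proof (rule mult_left_mono)
      show "- (?Y * E) \<le> m powr (2 * s) + \<gamma>" using h by (simp add: algebra_simps)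
    qed simp
    ultimately show ?thesis by (simp add: mult_ac)
  next
    assume "- (d powr (2 * s)) * (\<gamma> + m powr (2 * s)) < E"
    then show ?thesis by (simp add: algebra_simps)
  qed
  show ?thesis
  proof (cases "0 \<le> m powr (2 * s) + \<gamma>")
    case True
    then have "0 \<le> r powr (2 * s) * (m powr (2 * s) + \<gamma>)" by simp
    then show ?thesis using E by linarith
  next
    case False
    have "r powr (2 * s) \<le> d powr (2 * s)" using r s by (intro powr_mono2) auto
    then have "d powr (2 * s) * (m powr (2 * s) + \<gamma>) \<le> r powr (2 * s) * (m powr (2 * s) + \<gamma>)"
      using False by (intro mult_right_mono_neg) auto
    then show ?thesis using dE by linarith
  qed
qed

lemma inf_coeff_real:
  fixes w c :: "real ^ 'n \<Rightarrow> real"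
  assumes "bdd_below (c ` {x \<in> D. w x < 0})" "x \<in> D" "w x < 0"
  obtains \<gamma> where "inf_coeff D w c = ereal \<gamma>" "\<And>y. y \<in> D \<Longrightarrow> w y < 0 \<Longrightarrow> \<gamma> \<le> c y"
proof -
  have up: "inf_coeff D w c \<le> ereal (c y)" if "y \<in> D" "w y < 0" for y
    unfolding inf_coeff_def using that by (intro INF_lower) simp
  obtain b where "\<And>y. y \<in> D \<Longrightarrow> w y < 0 \<Longrightarrow> b \<le> c y"
    using assms(1) by (auto simp: bdd_below_def)
  then have "ereal b \<le> inf_coeff D w c"
    unfolding inf_coeff_def by (intro INF_greatest) auto
  then obtain \<gamma> where "inf_coeff D w c = ereal \<gamma>"
    using up[OF assms(2,3)] by (cases "inf_coeff D w c") auto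
  then show ?thesis using up that by auto
qed

text \<open>The factor in the hypothesis on the coefficient is strictly smaller than the one that the annulus
  estimate provides. This supplies the strict gap although the condition above is only used with \<open>\<le>\<close>.\<close>

lemma annulus_weight_less:
  fixes c2 q :: real
  assumes "1 < c2" "0 < q"
  shows "(1 / (c2 * (1 + c2))) powr q < c2 powr (- q)"
proof -
  have "c2 * 1 < c2 * (1 + c2)" using assms by (intro mult_strict_left_mono) auto
  then have "1 / (c2 * (1 + c2)) < 1 / c2" using assms by (intro divide_strict_left_mono) auto
  then have "(1 / (c2 * (1 + c2))) powr q < (1 / c2) powr q"
    using assms by (intro powr_less_mono2) auto
  also have "\<dots> = c2 powr (- q)" using assms by (simp add: powr_divide powr_minus field_simps)
  finally show ?thesis .
qed

theorem theorem3p8: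
  fixes s r0 :: real
  assumes "0 < s" and "s < 1"
    and "bessel_comparison_radius (real CARD('n::finite) / 2 + s) r0"
  shows "\<exists>C>0. \<forall>(m::real) (D::(real ^ 'n) set) (c1::real) (c2::real)
            (w::real ^ 'n \<Rightarrow> real) (c::real ^ 'n \<Rightarrow> real).
     0 < m \<and> open D \<and> 0 < c1 \<and> 1 < c2 \<and> exterior_density D c1 c2 \<and>
     w \<in> L_space s \<and> w \<in> C11_loc D \<and> bdd_below (range w) \<and> tail_integrable m s w \<and>
     (\<forall>x\<in>D. w x < 0 \<longrightarrow> bessel_op m s w x + c x * w x \<ge> 0) \<and>
     (\<forall>x\<in>-D. w x \<ge> 0) \<and>
     bdd_below (c ` {x \<in> D. w x < 0}) \<and>
     width D \<le> ennreal (r0 / (c2 * m)) \<and>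
     (inf_coeff D w c >
        ereal (- (1 + c2 powr (2 * s) * C / r0 powr (2 * s)
                    * (1 / (c2 * (1 + c2))) powr (real CARD('n) + 2 * s)
                    * (c2 ^ CARD('n) - 1) * c1) * m powr (2 * s))
      \<or>
      - ereal (enn2real (width D) powr (2 * s)) * (inf_coeff D w c + ereal (m powr (2 * s)))
        < ereal (C * (1 / (c2 * (1 + c2))) powr (real CARD('n) + 2 * s)
                   * (c2 ^ CARD('n) - 1) * c1))
     \<longrightarrow>
     (\<forall>x\<in>D. w x \<ge> 0) \<and>
     ((\<forall>x\<in>D. w x = 0 \<longrightarrow> bessel_op m s w x \<ge> 0) \<longrightarrow>
        (\<forall>x\<in>D. w x > 0) \<or> (AE x in lebesgue. w x = 0))"
proof -
  have \<nu>: "0 < real CARD('n) / 2 + s" using assms(1) by (simp add: add_nonneg_pos)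
  have r0: "0 < r0" using assms(3) by (simp add: bessel_comparison_radius_def)
  obtain c0 C1 where c0: "0 < c0" and C1: "0 < C1"
    and K: "\<And>r. 0 < r \<Longrightarrow> r \<le> r0 \<Longrightarrow> c0 * r powr (- (real CARD('n) / 2 + s)) \<le> bessel_K (real CARD('n) / 2 + s) r"
      "\<And>r. 0 < r \<Longrightarrow> bessel_K (real CARD('n) / 2 + s) r \<le> C1 * r powr (- (real CARD('n) / 2 + s))"
      "\<And>r. 0 < r \<Longrightarrow> 0 < bessel_K (real CARD('n) / 2 + s) r"
      "\<And>r r'. 0 < r \<Longrightarrow> r \<le> r' \<Longrightarrow> bessel_K (real CARD('n) / 2 + s) r' \<le> bessel_K (real CARD('n) / 2 + s) r"
    by (rule bessel_K_comparison[OF assms(3) \<nu>]) blast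
  \<comment> \<open>The factor of the main term that is independent of the domain, of \<open>m\<close> and of the density constants.\<close>
  define C where "C = op_const TYPE('n) s * c0 * unit_ball_vol (real CARD('n))"
  have C: "0 < C" unfolding C_def using op_const_pos[where 'n = 'n, OF assms(1,2)] c0 by simp
  show ?thesis
  proof (rule exI[of _ C], intro conjI C allI impI)
    fix m :: real and D :: "(real ^ 'n) set" and c1 c2 :: real and w c :: "real ^ 'n \<Rightarrow> real"
    let ?q = "real CARD('n) + 2 * s"
    define E where "E = C * (1 / (c2 * (1 + c2))) powr ?q * (c2 ^ CARD('n) - 1) * c1"
    assume "0 < m \<and> open D \<and> 0 < c1 \<and> 1 < c2 \<and> exterior_density D c1 c2 \<and>
     w \<in> L_space s \<and> w \<in> C11_loc D \<and> bdd_below (range w) \<and> tail_integrable m s w \<and>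
     (\<forall>x\<in>D. w x < 0 \<longrightarrow> bessel_op m s w x + c x * w x \<ge> 0) \<and>
     (\<forall>x\<in>-D. w x \<ge> 0) \<and>
     bdd_below (c ` {x \<in> D. w x < 0}) \<and>
     width D \<le> ennreal (r0 / (c2 * m)) \<and>
     (inf_coeff D w c >
        ereal (- (1 + c2 powr (2 * s) * C / r0 powr (2 * s)
                    * (1 / (c2 * (1 + c2))) powr (real CARD('n) + 2 * s)
                    * (c2 ^ CARD('n) - 1) * c1) * m powr (2 * s))
      \<or>
      - ereal (enn2real (width D) powr (2 * s)) * (inf_coeff D w c + ereal (m powr (2 * s)))
        < ereal (C * (1 / (c2 * (1 + c2))) powr (real CARD('n) + 2 * s)
                   * (c2 ^ CARD('n) - 1) * c1))"
    then have m: "0 < m" and D: "open D" and c1: "0 < c1" and c2: "1 < c2"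
      and dens: "exterior_density D c1 c2"
      and w: "w \<in> L_space s" "tail_integrable m s w" "w \<in> C11_loc D" and bdd: "bdd_below (range w)"
      and super: "\<forall>x\<in>D. w x < 0 \<longrightarrow> 0 \<le> bessel_op m s w x + c x * w x"
      and ext: "\<forall>x\<in>-D. 0 \<le> w x"
      and cb: "bdd_below (c ` {x \<in> D. w x < 0})"
      and wid: "width D \<le> ennreal (r0 / (c2 * m))"
      and cond: "ereal (- (1 + c2 powr (2 * s) * C / r0 powr (2 * s)
                    * (1 / (c2 * (1 + c2))) powr (real CARD('n) + 2 * s)
                    * (c2 ^ CARD('n) - 1) * c1) * m powr (2 * s)) < inf_coeff D w c
        \<or> - ereal (enn2real (width D) powr (2 * s)) * (inf_coeff D w c + ereal (m powr (2 * s)))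
          < ereal (C * (1 / (c2 * (1 + c2))) powr (real CARD('n) + 2 * s)
                   * (c2 ^ CARD('n) - 1) * c1)"
      by - (elim conjE, assumption)+
    interpret bessel_kernel_bounds "TYPE('n)" s r0 c0 C1 m
      by unfold_locales (use assms m c0 C1 K in auto)
    have pos: "0 < c2 ^ CARD('n) - 1" using c2 by (simp add: one_less_power)
    have EA: "0 \<le> E" "E < density_const TYPE('n) s c0 c1 c2"
    proof -
      show "0 \<le> E" unfolding E_def using C c1 pos by simp
      have q: "0 < ?q" using assms(1) by (simp add: add_nonneg_pos)
      have "C * (1 / (c2 * (1 + c2))) powr ?q < C * c2 powr (- ?q)"
        using annulus_weight_less[OF c2 q] C by (intro mult_strict_left_mono)
      then have "E < C * c2 powr (- ?q) * (c2 ^ CARD('n) - 1) * c1"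
        unfolding E_def using pos c1 by (intro mult_strict_right_mono)
      then show "E < density_const TYPE('n) s c0 c1 c2" by (simp only: density_const_def C_def)
    qed
    have B: "0 \<le> r0 / (c2 * m)" using r0 c2 m by simp
    have gap: "density_const TYPE('n) s c0 c1 c2 - E
        \<le> density_const TYPE('n) s c0 c1 c2 + infdist x (- D) powr (2 * s) * (m powr (2 * s) + c x)"
      if x: "x \<in> D" "w x < 0" for x
    proof -
      obtain \<gamma> where \<gamma>: "inf_coeff D w c = ereal \<gamma>" and \<gamma>_le: "\<gamma> \<le> c x"
        using inf_coeff_real[OF cb x] x by metis
      have "- E \<le> infdist x (- D) powr (2 * s) * (m powr (2 * s) + \<gamma>)"
      proof (rule coefficient_condition[OF assms(1) r0 c2 m EA(1)])
        show "- (1 + c2 powr (2 * s) / r0 powr (2 * s) * E) * m powr (2 * s) < \<gamma>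
           \<or> - (enn2real (width D) powr (2 * s)) * (\<gamma> + m powr (2 * s)) < E"
          using cond unfolding \<gamma> E_def by (simp add: mult_ac)
        show "0 \<le> infdist x (- D)" by (rule infdist_nonneg)
      qed (use finite_width_infdist[OF wid B D x(1)] in auto)
      also have "\<dots> \<le> infdist x (- D) powr (2 * s) * (m powr (2 * s) + c x)"
        using \<gamma>_le by (intro mult_left_mono) auto
      finally show ?thesis by simp
    qed
    have nonneg: "0 \<le> w x" for x
      by (rule nonneg_of_coefficient_gap[OF w D dens c2 r0 wid bdd _ _ _ gap])
         (use EA(2) ext super in simp_all)
    then show "\<forall>x\<in>D. 0 \<le> w x" by blast
    assume zero: "\<forall>x\<in>D. w x = 0 \<longrightarrow> 0 \<le> bessel_op m s w x"
    show "(\<forall>x\<in>D. 0 < w x) \<or> (AE x in lebesgue. w x = 0)"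
    proof (cases "\<forall>x\<in>D. 0 < w x")
      case False
      then obtain x where x: "x \<in> D" "w x = 0" using nonneg by (metis less_eq_real_def)
      obtain l where l: "(trunc w x \<longlongrightarrow> l) (at_right 0)"
        and op: "bessel_op m s w x = op_const TYPE('n) s * m powr (real CARD('n) / 2 + s) * l + m powr (2 * s) * w x"
        and int: "\<And>\<eta>. 0 < \<eta> \<Longrightarrow> set_integrable lebesgue (- ball x \<eta>) (\<lambda>y. (w x - w y) * bessel_kernel m s x y)"
        by (rule bessel_op_principal_value[OF w D x(1)]) blast
      have P: "0 < op_const TYPE('n) s * m powr (real CARD('n) / 2 + s)"
        using op_const_pos[where 'n = 'n, OF assms(1,2)] m by simp
      have "0 \<le> (op_const TYPE('n) s * m powr (real CARD('n) / 2 + s)) * l"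
        using zero[rule_format, OF x] op x(2) by simp
      then have "0 \<le> l" using P by (simp only: zero_le_mult_iff) auto
      then have "AE y in lebesgue. w y = 0"
        using AE_zero_of_principal_value_nonneg[OF nonneg x(2) _ int l] bessel_kernel_pos by metis
      then show ?thesis ..
    qed simp
  qed
qed

end
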